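(* Let $A=(A,\nabla_A,\eta_A,\Delta_A,\epsilon_A)$ and $B=(B,\nabla_B,\eta_B,\Delta_B,\epsilon_B)$ be Frobenius algebras over $k$, and let $\tau:B\otimes A\rightarrow A\otimes B$ be a twisting map. Then $(A\otimes_{\tau} B,\nabla_{A\otimes_{\tau} B},\eta_{A\otimes_{\tau} B},\Delta_{A\otimes_{\tau} B},\epsilon_{A\otimes_{\tau} B})$ is a Frobenius algebra if and only if $(A\otimes_{\tau} B,\Delta_{A\otimes_{\tau} B},\epsilon_{A\otimes_{\tau} B})$ is a counital coassociative coalgebra.
   Context: $k$ is a field of arbitrary characteristic, $\otimes=\otimes_k$, and $1$ denotes identity maps. Algebras are associative and unital, coalgebras are coassociative and counital. A Frobenius algebra over $k$ is a tuple $(A,\nabla,\eta,\Delta,\epsilon)$ with $(A,\nabla,\eta)$ a $k$-algebra, $(A,\Delta,\epsilon)$ a $k$-coalgebra, and $\Delta\nabla=(1\otimes\nabla)(\Delta\otimes 1)=(\nabla\otimes 1)(1\otimes\Delta)$. A twisting map for algebras $(A,\nabla_A,\eta_A)$, $(B,\nabla_B,\eta_B)$ is a bijective $k$-linear map $\tau:B\otimes A\to A\otimes B$ such that $\tau(b\otimes 1_A)=1_A\otimes b$ and $\tau(1_B\otimes a)=a\otimes 1_B$ for all $a\in A$, $b\in B$, and $\tau(\nabla_B\otimes\nabla_A)=(\nabla_A\otimes\nabla_B)(1\otimes\tau\otimes 1)(\tau\otimes\tau)(1\otimes\tau\otimes 1)$ as maps $B\otimes B\otimes A\otimes A\to A\otimes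 B$. The twisted tensor product $A\otimes_\tau B$ is the vector space $A\otimes B$ with $\nabla_{A\otimes_\tau B}=(\nabla_A\otimes\nabla_B)(1\otimes\tau\otimes 1)$, $\eta_{A\otimes_\tau B}=\eta_A\otimes\eta_B$, $\Delta_{A\otimes_\tau B}=(1\otimes\tau^{-1}\otimes 1)(\Delta_A\otimes\Delta_B)$, $\epsilon_{A\otimes_\tau B}=\epsilon_A\otimes\epsilon_B$ (using $k\otimes k\cong k$). *)

theory Defs
  imports "HOL-Algebra.AbelCoset" "Jordan_Normal_Form.Missing_VectorSpace"
begin

section \<open>Tensor products of vector spaces\<close>

text \<open>
  Vector spaces are HOL-Algebra module records \<open>V\<close> with \<^term>\<open>vectorspace K V\<close>; the fields
  \<^const>\<open>mult\<close> and \<^const>\<open>one\<close> of such a record are never used.  A linear map is a HOL function of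
  which only the restriction to the carrier matters (\<^const>\<open>linear_map\<close>), so equations between
  linear maps are stated pointwise on the carrier of the domain.
\<close>

definition free_module :: "('k, 'm) ring_scheme \<Rightarrow> 's set \<Rightarrow> ('k, 's \<Rightarrow> 'k) module" where
  "free_module K S = (ring.func_space K S)
     \<lparr>carrier := {f \<in> S \<rightarrow>\<^sub>E carrier K. finite {s \<in> S. f s \<noteq> \<zero>\<^bsub>K\<^esub>}}\<rparr>"

definition free_gen :: "('k, 'm) ring_scheme \<Rightarrow> 's set \<Rightarrow> 's \<Rightarrow> 's \<Rightarrow> 'k" where
  "free_gen K S s = (\<lambda>t\<in>S. if t = s then \<one>\<^bsub>K\<^esub> else \<zero>\<^bsub>K\<^esub>)"

text \<open>The scalar \<open>c\<close> acts on a coset by \<open>c (N + x) = N + c x\<close>; the union over representatives \<open>x\<close>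
  is of equal sets when \<open>N\<close> is a submodule.\<close>

definition quotient_module :: "('k, 'v, 'n) module_scheme \<Rightarrow> 'v set \<Rightarrow> ('k, 'v set) module" where
  "quotient_module M N =
    \<lparr>carrier = a_rcosets\<^bsub>M\<^esub> N,
     mult = (\<lambda>X Y. N), one = N,
     zero = N,
     add = (\<lambda>X Y. X <+>\<^bsub>M\<^esub> Y),
     smult = (\<lambda>c X. \<Union>x\<in>X. N +>\<^bsub>M\<^esub> (c \<odot>\<^bsub>M\<^esub> x))\<rparr>"

definition tensor_free ::
  "('k, 'm) ring_scheme \<Rightarrow> ('k, 'v, 'n) module_scheme \<Rightarrow> ('k, 'w, 'p) module_scheme
    \<Rightarrow> ('k, 'v \<times> 'w \<Rightarrow> 'k) module" where
  "tensor_free K V W = free_module K (carrier V \<times> carrier W)"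

abbreviation tensor_gen ::
  "('k, 'm) ring_scheme \<Rightarrow> ('k, 'v, 'n) module_scheme \<Rightarrow> ('k, 'w, 'p) module_scheme
    \<Rightarrow> 'v \<Rightarrow> 'w \<Rightarrow> 'v \<times> 'w \<Rightarrow> 'k" where
  "tensor_gen K V W v w \<equiv> free_gen K (carrier V \<times> carrier W) (v, w)"

definition tensor_relations ::
  "('k, 'm) ring_scheme \<Rightarrow> ('k, 'v, 'n) module_scheme \<Rightarrow> ('k, 'w, 'p) module_scheme
    \<Rightarrow> ('v \<times> 'w \<Rightarrow> 'k) set" where
  "tensor_relations K V W = (let F = tensor_free K V W; e = tensor_gen K V W in
      {e (v \<oplus>\<^bsub>V\<^esub> v') w \<ominus>\<^bsub>F\<^esub> (e v w \<oplus>\<^bsub>F\<^esub> e v' w) | v v' w.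
          v \<in> carrier V \<and> v' \<in> carrier V \<and> w \<in> carrier W}
    \<union> {e v (w \<oplus>\<^bsub>W\<^esub> w') \<ominus>\<^bsub>F\<^esub> (e v w \<oplus>\<^bsub>F\<^esub> e v w') | v w w'.
          v \<in> carrier V \<and> w \<in> carrier W \<and> w' \<in> carrier W}
    \<union> {e (c \<odot>\<^bsub>V\<^esub> v) w \<ominus>\<^bsub>F\<^esub> (c \<odot>\<^bsub>F\<^esub> e v w) | c v w.
          c \<in> carrier K \<and> v \<in> carrier V \<and> w \<in> carrier W}
    \<union> {e v (c \<odot>\<^bsub>W\<^esub> w) \<ominus>\<^bsub>F\<^esub> (c \<odot>\<^bsub>F\<^esub> e v w) | c v w.
          c \<in> carrier K \<and> v \<in> carrier V \<and> w \<in> carrier W})"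

definition tensor_null ::
  "('k, 'm) ring_scheme \<Rightarrow> ('k, 'v, 'n) module_scheme \<Rightarrow> ('k, 'w, 'p) module_scheme
    \<Rightarrow> ('v \<times> 'w \<Rightarrow> 'k) set" where
  "tensor_null K V W = module.span K (tensor_free K V W) (tensor_relations K V W)"

definition tensor ::
  "('k, 'm) ring_scheme \<Rightarrow> ('k, 'v, 'n) module_scheme \<Rightarrow> ('k, 'w, 'p) module_scheme
    \<Rightarrow> ('k, ('v \<times> 'w \<Rightarrow> 'k) set) module" where
  "tensor K V W = quotient_module (tensor_free K V W) (tensor_null K V W)"

definition pure_tensor ::
  "('k, 'm) ring_scheme \<Rightarrow> ('k, 'v, 'n) module_scheme \<Rightarrow> ('k, 'w, 'p) module_scheme
    \<Rightarrow> 'v \<Rightarrow> 'w \<Rightarrow> ('v \<times> 'w \<Rightarrow> 'k) set" where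
  "pure_tensor K V W v w = tensor_null K V W +>\<^bsub>tensor_free K V W\<^esub> tensor_gen K V W v w"

text \<open>The linear map out of \<open>V \<otimes> W\<close> induced by a bilinear map \<open>\<beta>\<close> into \<open>U\<close>: a class \<open>X\<close> is sent
  to \<open>\<Sum> x(v,w) \<beta>(v,w)\<close> for any representative \<open>x\<close> of \<open>X\<close>.  Bilinearity of \<open>\<beta>\<close> makes the image below
  a singleton.\<close>

definition tensor_lift ::
  "('k, 'm) ring_scheme \<Rightarrow> ('k, 'v, 'n) module_scheme \<Rightarrow> ('k, 'w, 'p) module_scheme
    \<Rightarrow> ('k, 'u, 'q) module_scheme \<Rightarrow> ('v \<Rightarrow> 'w \<Rightarrow> 'u) \<Rightarrow> ('v \<times> 'w \<Rightarrow> 'k) set \<Rightarrow> 'u" where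
  "tensor_lift K V W U \<beta> X = the_elem ((\<lambda>x.
     \<Oplus>\<^bsub>U\<^esub> p \<in> {p \<in> carrier V \<times> carrier W. x p \<noteq> \<zero>\<^bsub>K\<^esub>}. x p \<odot>\<^bsub>U\<^esub> \<beta> (fst p) (snd p)) ` X)"

text \<open>\<open>f \<otimes> g : V \<otimes> W \<rightarrow> V' \<otimes> W'\<close>\<close>

definition tensor_map ::
  "('k, 'm) ring_scheme \<Rightarrow> ('k, 'v, 'n) module_scheme \<Rightarrow> ('k, 'w, 'p) module_scheme
    \<Rightarrow> ('k, 'v2, 'n2) module_scheme \<Rightarrow> ('k, 'w2, 'p2) module_scheme
    \<Rightarrow> ('v \<Rightarrow> 'v2) \<Rightarrow> ('w \<Rightarrow> 'w2) \<Rightarrow> ('v \<times> 'w \<Rightarrow> 'k) set \<Rightarrow> ('v2 \<times> 'w2 \<Rightarrow> 'k) set" where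
  "tensor_map K V W V' W' f g =
     tensor_lift K V W (tensor K V' W') (\<lambda>v w. pure_tensor K V' W' (f v) (g w))"


section \<open>Canonical isomorphisms\<close>

text \<open>\<open>(U \<otimes> V) \<otimes> W \<rightarrow> U \<otimes> (V \<otimes> W)\<close> and its inverse\<close>

definition tassoc ::
  "('k, 'm) ring_scheme \<Rightarrow> ('k, 'u, 'n) module_scheme \<Rightarrow> ('k, 'v, 'p) module_scheme
    \<Rightarrow> ('k, 'w, 'q) module_scheme
    \<Rightarrow> (('u \<times> 'v \<Rightarrow> 'k) set \<times> 'w \<Rightarrow> 'k) set \<Rightarrow> ('u \<times> ('v \<times> 'w \<Rightarrow> 'k) set \<Rightarrow> 'k) set" where
  "tassoc K U V W =
     tensor_lift K (tensor K U V) W (tensor K U (tensor K V W))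
       (\<lambda>x w. tensor_lift K U V (tensor K U (tensor K V W))
          (\<lambda>u v. pure_tensor K U (tensor K V W) u (pure_tensor K V W v w)) x)"

definition tassoc_inv ::
  "('k, 'm) ring_scheme \<Rightarrow> ('k, 'u, 'n) module_scheme \<Rightarrow> ('k, 'v, 'p) module_scheme
    \<Rightarrow> ('k, 'w, 'q) module_scheme
    \<Rightarrow> ('u \<times> ('v \<times> 'w \<Rightarrow> 'k) set \<Rightarrow> 'k) set \<Rightarrow> (('u \<times> 'v \<Rightarrow> 'k) set \<times> 'w \<Rightarrow> 'k) set" where
  "tassoc_inv K U V W =
     tensor_lift K U (tensor K V W) (tensor K (tensor K U V) W)
       (\<lambda>u y. tensor_lift K V W (tensor K (tensor K U V) W)
          (\<lambda>v w. pure_tensor K (tensor K U V) W (pure_tensor K U V u v) w) y)"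

definition ground :: "('k, 'm) ring_scheme \<Rightarrow> ('k, 'k) module" where
  "ground K = \<lparr>carrier = carrier K, mult = mult K, one = \<one>\<^bsub>K\<^esub>, zero = \<zero>\<^bsub>K\<^esub>, add = add K,
     smult = mult K\<rparr>"

text \<open>\<open>k \<otimes> V \<rightarrow> V\<close>, \<open>V \<otimes> k \<rightarrow> V\<close>, and \<open>k \<rightarrow> k \<otimes> k\<close> (the inverse of \<^term>\<open>lunit K (ground K)\<close>)\<close>

definition lunit ::
  "('k, 'm) ring_scheme \<Rightarrow> ('k, 'v, 'n) module_scheme \<Rightarrow> ('k \<times> 'v \<Rightarrow> 'k) set \<Rightarrow> 'v" where
  "lunit K V = tensor_lift K (ground K) V V (\<lambda>c v. c \<odot>\<^bsub>V\<^esub> v)"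

definition runit ::
  "('k, 'm) ring_scheme \<Rightarrow> ('k, 'v, 'n) module_scheme \<Rightarrow> ('v \<times> 'k \<Rightarrow> 'k) set \<Rightarrow> 'v" where
  "runit K V = tensor_lift K V (ground K) V (\<lambda>v c. c \<odot>\<^bsub>V\<^esub> v)"

definition ground_split :: "('k, 'm) ring_scheme \<Rightarrow> 'k \<Rightarrow> ('k \<times> 'k \<Rightarrow> 'k) set" where
  "ground_split K c = pure_tensor K (ground K) (ground K) c \<one>\<^bsub>K\<^esub>"

text \<open>For \<open>\<sigma> : Y \<otimes> X \<rightarrow> Z \<otimes> Z'\<close>, the map \<open>1 \<otimes> \<sigma> \<otimes> 1\<close> on the four-fold tensor product, bracketed as
  \<open>(P \<otimes> Y) \<otimes> (X \<otimes> Q) \<rightarrow> (P \<otimes> Z) \<otimes> (Z' \<otimes> Q)\<close>.\<close>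

definition mid_map ::
  "('k, 'm) ring_scheme \<Rightarrow> ('k, 'p, 'm1) module_scheme
    \<Rightarrow> ('k, 'y, 'm2) module_scheme \<Rightarrow> ('k, 'x, 'm3) module_scheme
    \<Rightarrow> ('k, 'z, 'm4) module_scheme \<Rightarrow> ('k, 'z2, 'm5) module_scheme
    \<Rightarrow> ('k, 'q, 'm6) module_scheme
    \<Rightarrow> (('y \<times> 'x \<Rightarrow> 'k) set \<Rightarrow> ('z \<times> 'z2 \<Rightarrow> 'k) set)
    \<Rightarrow> (('p \<times> 'y \<Rightarrow> 'k) set \<times> ('x \<times> 'q \<Rightarrow> 'k) set \<Rightarrow> 'k) set
    \<Rightarrow> (('p \<times> 'z \<Rightarrow> 'k) set \<times> ('z2 \<times> 'q \<Rightarrow> 'k) set \<Rightarrow> 'k) set" where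
  "mid_map K P Y X Z Z' Q \<sigma> =
     tassoc_inv K P Z (tensor K Z' Q)
     \<circ> tensor_map K P (tensor K Y (tensor K X Q)) P (tensor K Z (tensor K Z' Q)) id
         (tassoc K Z Z' Q
          \<circ> tensor_map K (tensor K Y X) Q (tensor K Z Z') Q \<sigma> id
          \<circ> tassoc_inv K Y X Q)
     \<circ> tassoc K P Y (tensor K X Q)"


section \<open>Algebras, coalgebras, Frobenius algebras\<close>

text \<open>The \<^locale>\<open>algebra\<close> of HOL-Algebra is commutative, hence a separate locale.\<close>

locale k_algebra = vectorspace K A for K A +
  fixes nabla eta
  assumes nabla_linear: "linear_map K (tensor K A A) A nabla"
    and eta_linear: "linear_map K (ground K) A eta"
    and assoc: "\<And>x. x \<in> carrier (tensor K (tensor K A A) A) \<Longrightarrow>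
        (nabla \<circ> tensor_map K (tensor K A A) A A A nabla id) x
      = (nabla \<circ> tensor_map K A (tensor K A A) A A id nabla \<circ> tassoc K A A A) x"
    and unit_left: "\<And>x. x \<in> carrier (tensor K (ground K) A) \<Longrightarrow>
        (nabla \<circ> tensor_map K (ground K) A A A eta id) x = lunit K A x"
    and unit_right: "\<And>x. x \<in> carrier (tensor K A (ground K)) \<Longrightarrow>
        (nabla \<circ> tensor_map K A (ground K) A A id eta) x = runit K A x"

locale k_coalgebra = vectorspace K C for K C +
  fixes Delta epsilon
  assumes Delta_linear: "linear_map K C (tensor K C C) Delta"
    and epsilon_linear: "linear_map K C (ground K) epsilon"
    and coassoc: "\<And>x. x \<in> carrier C \<Longrightarrow>
        (tassoc K C C C \<circ> tensor_map K C C (tensor K C C) C Delta id \<circ> Delta) x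
      = (tensor_map K C C C (tensor K C C) id Delta \<circ> Delta) x"
    and counit_left: "\<And>x. x \<in> carrier C \<Longrightarrow>
        (lunit K C \<circ> tensor_map K C C (ground K) C epsilon id \<circ> Delta) x = x"
    and counit_right: "\<And>x. x \<in> carrier C \<Longrightarrow>
        (runit K C \<circ> tensor_map K C C C (ground K) id epsilon \<circ> Delta) x = x"

locale frobenius_algebra =
  k_algebra K A nabla eta + k_coalgebra K A Delta epsilon
  for K A nabla eta Delta epsilon +
  assumes frobenius_left: "\<And>x. x \<in> carrier (tensor K A A) \<Longrightarrow>
        (Delta \<circ> nabla) x
      = (tensor_map K A (tensor K A A) A A id nabla
         \<circ> tassoc K A A A
         \<circ> tensor_map K A A (tensor K A A) A Delta id) x"
    and frobenius_right: "\<And>x. x \<in> carrier (tensor K A A) \<Longrightarrow>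
        (Delta \<circ> nabla) x
      = (tensor_map K (tensor K A A) A A A nabla id
         \<circ> tassoc_inv K A A A
         \<circ> tensor_map K A A A (tensor K A A) id Delta) x"


section \<open>Twisted tensor products\<close>

text \<open>The unit element \<open>1\<^sub>A\<close> is \<open>eta\<^sub>A(1)\<close>.\<close>

locale twisting_map =
  A: k_algebra K A nablaA etaA + B: k_algebra K B nablaB etaB
  for K A nablaA etaA B nablaB etaB +
  fixes tau
  assumes tau_linear: "linear_map K (tensor K B A) (tensor K A B) tau"
    and tau_bij: "bij_betw tau (carrier (tensor K B A)) (carrier (tensor K A B))"
    and tau_unit_A: "\<And>b. b \<in> carrier B \<Longrightarrow>
        tau (pure_tensor K B A b (etaA \<one>\<^bsub>K\<^esub>)) = pure_tensor K A B (etaA \<one>\<^bsub>K\<^esub>) b"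
    and tau_unit_B: "\<And>a. a \<in> carrier A \<Longrightarrow>
        tau (pure_tensor K B A (etaB \<one>\<^bsub>K\<^esub>) a) = pure_tensor K A B a (etaB \<one>\<^bsub>K\<^esub>)"
    and tau_mult: "\<And>x. x \<in> carrier (tensor K (tensor K B B) (tensor K A A)) \<Longrightarrow>
        (tau \<circ> tensor_map K (tensor K B B) (tensor K A A) B A nablaB nablaA) x
      = (tensor_map K (tensor K A A) (tensor K B B) A B nablaA nablaB
         \<circ> mid_map K A B A A B B tau
         \<circ> tensor_map K (tensor K B A) (tensor K B A) (tensor K A B) (tensor K A B) tau tau
         \<circ> mid_map K B B A A B A tau) x"

definition twisted_mult where
  "twisted_mult K A nablaA B nablaB tau =
     tensor_map K (tensor K A A) (tensor K B B) A B nablaA nablaB \<circ> mid_map K A B A A B B tau"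

definition twisted_unit where
  "twisted_unit K A etaA B etaB =
     tensor_map K (ground K) (ground K) A B etaA etaB \<circ> ground_split K"

definition twisted_comult where
  "twisted_comult K A DeltaA B DeltaB tau =
     mid_map K A A B B A B (inv_into (carrier (tensor K B A)) tau)
     \<circ> tensor_map K A B (tensor K A A) (tensor K B B) DeltaA DeltaB"

definition twisted_counit where
  "twisted_counit K A epsilonA B epsilonB =
     lunit K (ground K) \<circ> tensor_map K A B (ground K) (ground K) epsilonA epsilonB"

end

theory Submission
  imports Defs
begin

text \<open>
  Write \<open>R = A \<otimes>\<^sub>\<tau> B\<close>, in which
  \<open>a \<otimes> b = a b\<close> and \<open>\<tau>(b \<otimes> a) = b a\<close>.  The counit axioms give
  \<open>(1 \<otimes> \<epsilon>\<^sub>B) \<tau> = \<epsilon>\<^sub>B \<otimes> 1\<close> and \<open>(\<epsilon>\<^sub>A \<otimes> 1) \<tau> = 1 \<otimes> \<epsilon>\<^sub>A\<close>, so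
  \<open>E\<^sub>B = 1 \<otimes> \<epsilon>\<^sub>B : R \<rightarrow> A\<close> is a map of \<open>A\<close>-bimodules and \<open>E\<^sub>A = \<epsilon>\<^sub>A \<otimes> 1 : R \<rightarrow> B\<close> a map of
  \<open>B\<close>-bimodules.  If \<open>\<Sum> e \<otimes> f = \<Delta>\<^sub>A(1)\<close> and \<open>\<Sum> u \<otimes> v = \<Delta>\<^sub>B(1)\<close>, then every \<open>x \<in> R\<close> satisfies
  \<open>x = \<Sum> E\<^sub>A(x e) f = \<Sum> e E\<^sub>A(f x) = \<Sum> E\<^sub>B(x u) v = \<Sum> u E\<^sub>B(v x)\<close>; in each case it suffices to check
  \<open>x = b a\<close> or \<open>x = a b\<close>.  Hence \<open>C = \<Delta>\<^sub>R(1)\<close> is dual on both sides to the form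
  \<open>\<epsilon>\<^sub>R(x y)\<close>, which forces \<open>x C = C x\<close>.  As \<open>\<Delta>\<^sub>R(a b) = a C b\<close>, this gives
  \<open>\<Delta>\<^sub>R(x) = x C = C x\<close>, and both Frobenius identities follow from associativity.
\<close>

section \<open>Tensor products\<close>

lemma linear_mapI:
  assumes "vectorspace K V" "vectorspace K W"
    and "\<And>v. v \<in> carrier V \<Longrightarrow> f v \<in> carrier W"
    and "\<And>v v'. v \<in> carrier V \<Longrightarrow> v' \<in> carrier V \<Longrightarrow> f (v \<oplus>\<^bsub>V\<^esub> v') = f v \<oplus>\<^bsub>W\<^esub> f v'"
    and "\<And>c v. c \<in> carrier K \<Longrightarrow> v \<in> carrier V \<Longrightarrow> f (c \<odot>\<^bsub>V\<^esub> v) = c \<odot>\<^bsub>W\<^esub> f v"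
  shows "linear_map K V W f"
  using assms unfolding linear_map_def mod_hom_def mod_hom_axioms_def module_hom_def vectorspace_def
  by auto

section \<open>Quotients of vector spaces\<close>

text \<open>A submodule is closed under negatives, which are multiples by \<open>-1\<close>, so the
  coset calculus of abelian subgroups provides the additive structure. Only the scalar action needs
  its own proof of being well defined.\<close>

lemma quotient_module:
  assumes M: "vectorspace K M" and N: "LinearCombinations.submodule K N M"
  shows quotient_vectorspace: "vectorspace K (quotient_module M N)"
    and quotient_linear: "linear_map K M (quotient_module M N) (\<lambda>x. N +>\<^bsub>M\<^esub> x)"
    and quotient_mem_coset: "x \<in> carrier M \<Longrightarrow> x \<in> N +>\<^bsub>M\<^esub> x"
    and quotient_mem_cosetD: "x \<in> carrier M \<Longrightarrow> y \<in> N +>\<^bsub>M\<^esub> x \<Longrightarrow> y \<in> carrier M \<and> y \<ominus>\<^bsub>M\<^esub> x \<in> N"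
    and quotient_coset_eq: "x \<in> carrier M \<Longrightarrow> y \<in> carrier M \<Longrightarrow> y \<ominus>\<^bsub>M\<^esub> x \<in> N \<Longrightarrow> N +>\<^bsub>M\<^esub> x = N +>\<^bsub>M\<^esub> y"
    and quotient_carrierE: "X \<in> carrier (quotient_module M N) \<Longrightarrow> \<exists>x\<in>carrier M. X = N +>\<^bsub>M\<^esub> x"
proof -
  interpret M: vectorspace K M by fact
  interpret N: LinearCombinations.submodule K N M by fact
  let ?Q = "quotient_module M N"
  have "\<ominus>\<^bsub>M\<^esub> x \<in> N" if "x \<in> N" for x
    using N.smult_closed[of "\<ominus>\<^bsub>K\<^esub> \<one>\<^bsub>K\<^esub>" x] that subsetD[OF N.subset that] by (simp add: M.smult_l_minus)
  then have sub: "subgroup N (add_monoid M)"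
    using N.subset by (intro M.add.subgroupI) (auto simp: a_inv_def intro: N.zero_closed)
  interpret S: abelian_subgroup N M
    by (rule abelian_subgroupI3[OF additive_subgroup.intro[OF sub] M.abelian_group_axioms])
  show E: "\<exists>x\<in>carrier M. X = N +>\<^bsub>M\<^esub> x" if "X \<in> carrier ?Q" for X
    using that by (auto simp: quotient_module_def A_RCOSETS_def')
  show m: "x \<in> N +>\<^bsub>M\<^esub> x" if "x \<in> carrier M" for x
    using that by (rule S.a_rcos_self)
  show D: "y \<in> carrier M \<and> y \<ominus>\<^bsub>M\<^esub> x \<in> N" if "x \<in> carrier M" "y \<in> N +>\<^bsub>M\<^esub> x" for x y
    using S.a_elemrcos_carrier[OF that] S.a_rcos_module_imp[OF that] by (simp add: a_minus_def)
  have C: "N +>\<^bsub>M\<^esub> x \<in> carrier ?Q" if "x \<in> carrier M" for x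
    using that M.a_rcosetsI[OF S.a_subset that] by (simp add: quotient_module_def)
  have A: "(N +>\<^bsub>M\<^esub> x) \<oplus>\<^bsub>?Q\<^esub> (N +>\<^bsub>M\<^esub> y) = N +>\<^bsub>M\<^esub> (x \<oplus>\<^bsub>M\<^esub> y)" if "x \<in> carrier M" "y \<in> carrier M" for x y
    using that by (simp add: quotient_module_def S.a_rcos_sum)
  have Z: "\<zero>\<^bsub>?Q\<^esub> = N +>\<^bsub>M\<^esub> \<zero>\<^bsub>M\<^esub>"
    by (simp add: quotient_module_def S.a_subset)
  show eqI: "N +>\<^bsub>M\<^esub> x = N +>\<^bsub>M\<^esub> y" if "x \<in> carrier M" "y \<in> carrier M" "y \<ominus>\<^bsub>M\<^esub> x \<in> N" for x y
    using S.a_repr_independence'[OF S.a_rcos_module_rev, of x y] that by (simp add: a_minus_def)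
  \<comment> \<open>All representatives \<open>y\<close> contribute the same coset to the union in
    \<open>quotient_module\<close>, because \<open>c y - c x = c (y - x)\<close> lies in
    \<open>N\<close>.\<close>
  have Sm: "c \<odot>\<^bsub>?Q\<^esub> (N +>\<^bsub>M\<^esub> x) = N +>\<^bsub>M\<^esub> (c \<odot>\<^bsub>M\<^esub> x)" if c: "c \<in> carrier K" and x: "x \<in> carrier M" for c x
  proof -
    have "N +>\<^bsub>M\<^esub> (c \<odot>\<^bsub>M\<^esub> y) = N +>\<^bsub>M\<^esub> (c \<odot>\<^bsub>M\<^esub> x)" if y: "y \<in> N +>\<^bsub>M\<^esub> x" for y
    proof -
      have y': "y \<in> carrier M" "y \<ominus>\<^bsub>M\<^esub> x \<in> N" using D[OF x y] by auto
      have "c \<odot>\<^bsub>M\<^esub> y \<ominus>\<^bsub>M\<^esub> c \<odot>\<^bsub>M\<^esub> x = c \<odot>\<^bsub>M\<^esub> (y \<ominus>\<^bsub>M\<^esub> x)"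
        using c x y' by (simp add: a_minus_def M.smult_r_distr M.smult_r_minus)
      then show ?thesis using eqI[of "c \<odot>\<^bsub>M\<^esub> x" "c \<odot>\<^bsub>M\<^esub> y"] c x y' by auto
    qed
    then have "(\<Union>y\<in>N +>\<^bsub>M\<^esub> x. N +>\<^bsub>M\<^esub> (c \<odot>\<^bsub>M\<^esub> y)) = (\<Union>y\<in>N +>\<^bsub>M\<^esub> x. N +>\<^bsub>M\<^esub> (c \<odot>\<^bsub>M\<^esub> x))"
      by (rule SUP_cong[OF refl])
    then show ?thesis using m[OF x] by (auto simp: quotient_module_def)
  qed
  show V: "vectorspace K ?Q"
    unfolding vectorspace_def
  proof
    show "module K ?Q"
    proof (rule module_criteria[OF M.is_cring])
      show "\<forall>v\<in>carrier ?Q. \<exists>n\<in>carrier ?Q. v \<oplus>\<^bsub>?Q\<^esub> n = \<zero>\<^bsub>?Q\<^esub>"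
      proof
        fix v assume "v \<in> carrier ?Q"
        then obtain x where x: "x \<in> carrier M" "v = N +>\<^bsub>M\<^esub> x" using E by blast
        show "\<exists>n\<in>carrier ?Q. v \<oplus>\<^bsub>?Q\<^esub> n = \<zero>\<^bsub>?Q\<^esub>"
          by (rule bexI[of _ "N +>\<^bsub>M\<^esub> (\<ominus>\<^bsub>M\<^esub> x)"]) (use x in \<open>auto simp: A C Z M.r_neg\<close>)
      qed
    qed (auto dest!: E simp: A Sm C Z M.a_ac M.smult_l_distr M.smult_r_distr M.smult_assoc1)
  qed (rule M.field_axioms)
  show "linear_map K M ?Q (\<lambda>x. N +>\<^bsub>M\<^esub> x)"
    by (rule linear_mapI[OF M V]) (auto simp: A C Sm)
qed

section \<open>Free vector spaces and linear extension from generators\<close>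

lemma free_module_simps:
  assumes "field K"
  shows carrier_free_module: "f \<in> carrier (free_module K S) \<longleftrightarrow>
        f \<in> S \<rightarrow>\<^sub>E carrier K \<and> finite {s \<in> S. f s \<noteq> \<zero>\<^bsub>K\<^esub>}"
    and add_free_module: "f \<oplus>\<^bsub>free_module K S\<^esub> g = (\<lambda>s\<in>S. f s \<oplus>\<^bsub>K\<^esub> g s)"
    and smult_free_module: "c \<odot>\<^bsub>free_module K S\<^esub> f = (\<lambda>s\<in>S. c \<otimes>\<^bsub>K\<^esub> f s)"
    and zero_free_module: "\<zero>\<^bsub>free_module K S\<^esub> = (\<lambda>s\<in>S. \<zero>\<^bsub>K\<^esub>)"
proof -
  interpret field K by fact
  show "f \<in> carrier (free_module K S) \<longleftrightarrow>
        f \<in> S \<rightarrow>\<^sub>E carrier K \<and> finite {s \<in> S. f s \<noteq> \<zero>\<^bsub>K\<^esub>}"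
    "f \<oplus>\<^bsub>free_module K S\<^esub> g = (\<lambda>s\<in>S. f s \<oplus>\<^bsub>K\<^esub> g s)"
    "c \<odot>\<^bsub>free_module K S\<^esub> f = (\<lambda>s\<in>S. c \<otimes>\<^bsub>K\<^esub> f s)"
    "\<zero>\<^bsub>free_module K S\<^esub> = (\<lambda>s\<in>S. \<zero>\<^bsub>K\<^esub>)"
    by (auto simp: free_module_def func_space_def)
qed

lemma free_module_vectorspace:
  assumes "field K"
  shows "vectorspace K (free_module K S)"
proof -
  interpret field K by fact
  let ?N = "{f \<in> S \<rightarrow>\<^sub>E carrier K. finite {s \<in> S. f s \<noteq> \<zero>\<^bsub>K\<^esub>}}"
  interpret F: module K "func_space S" by (rule func_space_is_module)
  have "LinearCombinations.submodule K ?N (func_space S)"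
  proof (rule LinearCombinations.submodule.intro, rule F.module_axioms)
    show "v \<oplus>\<^bsub>func_space S\<^esub> w \<in> ?N" if "v \<in> ?N" "w \<in> ?N" for v w
    proof -
      have "finite {s \<in> S. v s \<oplus>\<^bsub>K\<^esub> w s \<noteq> \<zero>\<^bsub>K\<^esub>}"
        by (rule finite_subset[of _ "{s \<in> S. v s \<noteq> \<zero>\<^bsub>K\<^esub>} \<union> {s \<in> S. w s \<noteq> \<zero>\<^bsub>K\<^esub>}"]) (use that in auto)
      then show ?thesis using that by (auto simp: func_space_def cong: conj_cong)
    qed
    show "c \<odot>\<^bsub>func_space S\<^esub> v \<in> ?N" if "c \<in> carrier K" "v \<in> ?N" for c v
    proof -
      have "finite {s \<in> S. c \<otimes>\<^bsub>K\<^esub> v s \<noteq> \<zero>\<^bsub>K\<^esub>}"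
        by (rule finite_subset[of _ "{s \<in> S. v s \<noteq> \<zero>\<^bsub>K\<^esub>}"]) (use that in auto)
      then show ?thesis using that by (auto simp: func_space_def cong: conj_cong)
    qed
  qed (auto simp: func_space_def)
  then have "module K (free_module K S)"
    unfolding free_module_def by (rule F.submodule_is_module)
  then show ?thesis
    unfolding vectorspace_def using field_axioms by auto
qed

lemma free_gen_closed:
  assumes "field K" "s \<in> S"
  shows "free_gen K S s \<in> carrier (free_module K S)"
proof -
  interpret field K by fact
  have "finite {t \<in> S. free_gen K S s t \<noteq> \<zero>\<^bsub>K\<^esub>}"
    by (rule finite_subset[of _ "{s}"]) (auto simp: free_gen_def)
  then show ?thesis
    by (auto simp: carrier_free_module[OF assms(1)] free_gen_def)
qed

text \<open>Induction on the size of the support: clearing one point \<open>s\<close> of the support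
  leaves \<open>y\<close> with one point fewer, and the part removed is a multiple of a
  generator.\<close>

lemma free_module_linear_ext:
  assumes f: "linear_map K (free_module K S) U f" and g: "linear_map K (free_module K S) U g"
    and eq: "\<And>s. s \<in> S \<Longrightarrow> f (free_gen K S s) = g (free_gen K S s)"
    and x: "x \<in> carrier (free_module K S)"
  shows "f x = g x"
proof -
  interpret f: linear_map K "free_module K S" U f by fact
  interpret g: linear_map K "free_module K S" U g by fact
  let ?F = "free_module K S"
  note simps = free_module_simps[OF f.field_axioms]
  show ?thesis using x
  proof (induction "card {s \<in> S. x s \<noteq> \<zero>\<^bsub>K\<^esub>}" arbitrary: x)
    case 0
    then have "x = \<zero>\<^bsub>?F\<^esub>" by (auto simp: simps fun_eq_iff PiE_def extensional_def)
    then show ?case by simp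
  next
    case (Suc n)
    then obtain s where s: "s \<in> S" "x s \<noteq> \<zero>\<^bsub>K\<^esub>" by (metis (mono_tags, lifting) card.empty empty_Collect_eq nat.distinct(1))
    define y where "y = x(s := \<zero>\<^bsub>K\<^esub>)"
    have x: "x \<in> S \<rightarrow>\<^sub>E carrier K" "finite {s \<in> S. x s \<noteq> \<zero>\<^bsub>K\<^esub>}" using Suc.prems by (auto simp: simps)
    have supp: "{t \<in> S. y t \<noteq> \<zero>\<^bsub>K\<^esub>} = {s \<in> S. x s \<noteq> \<zero>\<^bsub>K\<^esub>} - {s}" using s by (auto simp: y_def)
    then have n: "n = card {t \<in> S. y t \<noteq> \<zero>\<^bsub>K\<^esub>}" using Suc.hyps(2) s x by simp
    have y: "y \<in> carrier ?F"
      using x s supp by (auto simp: simps y_def PiE_def extensional_def)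
    have xs: "x s \<in> carrier K" using x s by auto
    have "x = x s \<odot>\<^bsub>?F\<^esub> free_gen K S s \<oplus>\<^bsub>?F\<^esub> y"
    proof
      fix t show "x t = (x s \<odot>\<^bsub>?F\<^esub> free_gen K S s \<oplus>\<^bsub>?F\<^esub> y) t"
      proof (cases "t \<in> S")
        case True
        then have "x t \<in> carrier K" using x by auto
        then show ?thesis using True xs by (simp add: simps y_def free_gen_def)
      next
        case False
        then show ?thesis using x by (simp add: simps PiE_def extensional_def)
      qed
    qed
    then obtain z where z: "x = z \<oplus>\<^bsub>?F\<^esub> y" and zd: "z = x s \<odot>\<^bsub>?F\<^esub> free_gen K S s" by blast
    have zc: "z \<in> carrier ?F" and "f z = g z"
      unfolding zd using xs free_gen_closed[OF f.field_axioms s(1)] eq[OF s(1)] by auto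
    then show ?case unfolding z using y Suc.hyps(1)[OF n y] by simp
  qed
qed

text \<open>The sum inside \<open>tensor_lift\<close> at a single representative, isolated as the
  linear extension of a function on generators.\<close>

abbreviation free_lift ::
  "('k, 'm) ring_scheme \<Rightarrow> 's set \<Rightarrow> ('k, 'u, 'q) module_scheme \<Rightarrow> ('s \<Rightarrow> 'u) \<Rightarrow> ('s \<Rightarrow> 'k) \<Rightarrow> 'u" where
  "free_lift K S U f x \<equiv> \<Oplus>\<^bsub>U\<^esub> p \<in> {p \<in> S. x p \<noteq> \<zero>\<^bsub>K\<^esub>}. x p \<odot>\<^bsub>U\<^esub> f p"

lemma free_lift:
  assumes U: "vectorspace K U" and f: "f \<in> S \<rightarrow> carrier U"
  shows free_lift_linear: "linear_map K (free_module K S) U (free_lift K S U f)"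
    and free_lift_gen: "s \<in> S \<Longrightarrow> free_lift K S U f (free_gen K S s) = f s"
proof -
  interpret U: vectorspace K U by fact
  note simps = free_module_simps[OF U.field_axioms]
  let ?F = "free_module K S"
  let ?supp = "\<lambda>x. {p \<in> S. x p \<noteq> \<zero>\<^bsub>K\<^esub>}"
  have fc: "f p \<in> carrier U" if "p \<in> S" for p using f that by auto
  have xc: "x p \<in> carrier K" if "x \<in> carrier ?F" "p \<in> S" for x p using that by (auto simp: simps)
  \<comment> \<open>Terms outside the support vanish, so sums over different supports can be
    compared over one common finite set.\<close>
  have extend: "free_lift K S U f x = (\<Oplus>\<^bsub>U\<^esub> p \<in> T. x p \<odot>\<^bsub>U\<^esub> f p)"
    if "x \<in> carrier ?F" "finite T" "?supp x \<subseteq> T" "T \<subseteq> S" for x T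
    by (rule U.M.add.finprod_mono_neutral_cong_left)
      (use that in \<open>auto simp: subset_iff intro!: U.smult_l_null U.smult_closed fc xc\<close>)
  have c: "(\<lambda>p. x p \<odot>\<^bsub>U\<^esub> f p) \<in> S \<rightarrow> carrier U" if "x \<in> carrier ?F" for x
    using fc xc that by auto
  interpret F: vectorspace K ?F by (rule free_module_vectorspace[OF U.field_axioms])
  show "linear_map K ?F U (free_lift K S U f)"
  proof (rule linear_mapI[OF F.vectorspace_axioms U])
    show "free_lift K S U f x \<in> carrier U" if "x \<in> carrier ?F" for x
      using c[OF that] by (intro U.M.finsum_closed) auto
    show "free_lift K S U f (x \<oplus>\<^bsub>?F\<^esub> y) = free_lift K S U f x \<oplus>\<^bsub>U\<^esub> free_lift K S U f y"
      if xy: "x \<in> carrier ?F" "y \<in> carrier ?F" for x y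
    proof -
      let ?T = "?supp x \<union> ?supp y"
      have fin: "finite ?T" using xy by (auto simp: simps)
      have xy': "x \<oplus>\<^bsub>?F\<^esub> y \<in> carrier ?F" using xy by simp
      have "free_lift K S U f (x \<oplus>\<^bsub>?F\<^esub> y) = (\<Oplus>\<^bsub>U\<^esub> p \<in> ?T. (x \<oplus>\<^bsub>?F\<^esub> y) p \<odot>\<^bsub>U\<^esub> f p)"
        by (rule extend[OF xy' fin]) (use xy in \<open>auto simp: simps\<close>)
      also have "\<dots> = (\<Oplus>\<^bsub>U\<^esub> p \<in> ?T. x p \<odot>\<^bsub>U\<^esub> f p \<oplus>\<^bsub>U\<^esub> y p \<odot>\<^bsub>U\<^esub> f p)"
        by (rule U.M.finsum_cong') (use xy in \<open>auto simp: add_free_module[OF U.field_axioms] U.smult_l_distr fc xc\<close>)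
      also have "\<dots> = (\<Oplus>\<^bsub>U\<^esub> p \<in> ?T. x p \<odot>\<^bsub>U\<^esub> f p) \<oplus>\<^bsub>U\<^esub> (\<Oplus>\<^bsub>U\<^esub> p \<in> ?T. y p \<odot>\<^bsub>U\<^esub> f p)"
        by (rule U.M.finsum_addf) (use c xy in auto)
      finally show ?thesis using extend[OF xy(1) fin] extend[OF xy(2) fin] by auto
    qed
    show "free_lift K S U f (k \<odot>\<^bsub>?F\<^esub> x) = k \<odot>\<^bsub>U\<^esub> free_lift K S U f x"
      if k: "k \<in> carrier K" and x: "x \<in> carrier ?F" for k x
    proof -
      have fin: "finite (?supp x)" using x by (auto simp: simps)
      have kx: "k \<odot>\<^bsub>?F\<^esub> x \<in> carrier ?F" using k x by simp
      have "free_lift K S U f (k \<odot>\<^bsub>?F\<^esub> x) = (\<Oplus>\<^bsub>U\<^esub> p \<in> ?supp x. (k \<odot>\<^bsub>?F\<^esub> x) p \<odot>\<^bsub>U\<^esub> f p)"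
        by (rule extend[OF kx fin]) (use k in \<open>auto simp: simps\<close>)
      also have "\<dots> = (\<Oplus>\<^bsub>U\<^esub> p \<in> ?supp x. k \<odot>\<^bsub>U\<^esub> (x p \<odot>\<^bsub>U\<^esub> f p))"
        by (rule U.M.finsum_cong') (use k x in \<open>auto simp: smult_free_module[OF U.field_axioms] U.smult_assoc1 fc xc\<close>)
      also have "\<dots> = k \<odot>\<^bsub>U\<^esub> free_lift K S U f x"
        by (rule U.finsum_smult_ldistr[symmetric, OF fin k]) (use c[OF x] in auto)
      finally show ?thesis .
    qed
  qed
  show "free_lift K S U f (free_gen K S s) = f s" if s: "s \<in> S"
  proof -
    have "?supp (free_gen K S s) = {s}" using s by (auto simp: free_gen_def)
    moreover have "(\<Oplus>\<^bsub>U\<^esub> p \<in> insert s {}. free_gen K S s p \<odot>\<^bsub>U\<^esub> f p) = f s"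
      using s fc[OF s] by (subst U.M.finsum_insert) (auto simp: free_gen_def)
    ultimately show ?thesis by simp
  qed
qed

section \<open>Bilinear maps and composites of linear maps\<close>

text \<open>The vector space conditions are listed separately because the quantified conditions
  alone would hold vacuously on empty carriers.\<close>

definition bilinear_map ::
  "('k, 'm) ring_scheme \<Rightarrow> ('k, 'v, 'n) module_scheme \<Rightarrow> ('k, 'w, 'p) module_scheme
    \<Rightarrow> ('k, 'u, 'q) module_scheme \<Rightarrow> ('v \<Rightarrow> 'w \<Rightarrow> 'u) \<Rightarrow> bool" where
  "bilinear_map K V W U \<beta> \<longleftrightarrow> vectorspace K V \<and> vectorspace K W \<and> vectorspace K U \<and>
     (\<forall>v\<in>carrier V. linear_map K W U (\<beta> v)) \<and> (\<forall>w\<in>carrier W. linear_map K V U (\<lambda>v. \<beta> v w))"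

lemma bilinear_mapI:
  assumes "vectorspace K V" "vectorspace K W"
    and "\<And>v. v \<in> carrier V \<Longrightarrow> linear_map K W U (\<beta> v)"
    and "\<And>w. w \<in> carrier W \<Longrightarrow> linear_map K V U (\<lambda>v. \<beta> v w)"
  shows "bilinear_map K V W U \<beta>"
proof -
  interpret V: vectorspace K V by fact
  have "vectorspace K U" using assms(3)[OF V.M.zero_closed] by (simp add: linear_map_def)
  then show ?thesis using assms by (simp add: bilinear_map_def)
qed

lemma linear_map_closed: "linear_map K V W f \<Longrightarrow> v \<in> carrier V \<Longrightarrow> f v \<in> carrier W"
  by (auto simp: linear_map_def mod_hom_def mod_hom_axioms_def module_hom_def)

lemma linear_map_add:
  "linear_map K V W f \<Longrightarrow> v \<in> carrier V \<Longrightarrow> v' \<in> carrier V \<Longrightarrow> f (v \<oplus>\<^bsub>V\<^esub> v') = f v \<oplus>\<^bsub>W\<^esub> f v'"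
  by (auto simp: linear_map_def mod_hom_def mod_hom_axioms_def module_hom_def)

lemma linear_map_smult:
  "linear_map K V W f \<Longrightarrow> c \<in> carrier K \<Longrightarrow> v \<in> carrier V \<Longrightarrow> f (c \<odot>\<^bsub>V\<^esub> v) = c \<odot>\<^bsub>W\<^esub> f v"
  by (auto simp: linear_map_def mod_hom_def mod_hom_axioms_def module_hom_def)

lemma linear_map_dom: "linear_map K V W f \<Longrightarrow> vectorspace K V"
  and linear_map_cod: "linear_map K V W f \<Longrightarrow> vectorspace K W"
  by (auto simp: linear_map_def)

lemma linear_map_id: "vectorspace K V \<Longrightarrow> linear_map K V V (\<lambda>x. x)"
  by (rule linear_mapI) auto

lemma linear_map_comp:
  assumes "linear_map K V W g" "linear_map K U V f"
  shows "linear_map K U W (\<lambda>x. g (f x))"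
  by (rule linear_mapI)
    (use assms in \<open>auto intro: linear_map_dom linear_map_cod linear_map_closed
      simp: linear_map_closed linear_map_add linear_map_smult\<close>)

lemma linear_map_cong:
  assumes "linear_map K V W f" "\<And>x. x \<in> carrier V \<Longrightarrow> f x = g x"
  shows "linear_map K V W g"
proof -
  interpret V: vectorspace K V using assms(1) by (rule linear_map_dom)
  show ?thesis
    by (rule linear_mapI)
      (use assms in \<open>auto intro: linear_map_dom linear_map_cod
        simp: linear_map_closed linear_map_add linear_map_smult simp flip: assms(2)\<close>)
qed

lemma bilinear_mapD:
  assumes "bilinear_map K V W U \<beta>"
  shows bilinear_left: "linear_map K X V g \<Longrightarrow> w \<in> carrier W \<Longrightarrow> linear_map K X U (\<lambda>x. \<beta> (g x) w)"
    and bilinear_right: "linear_map K X W h \<Longrightarrow> v \<in> carrier V \<Longrightarrow> linear_map K X U (\<lambda>x. \<beta> v (h x))"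
    and bilinear_closed: "v \<in> carrier V \<Longrightarrow> w \<in> carrier W \<Longrightarrow> \<beta> v w \<in> carrier U"
proof -
  show "linear_map K X U (\<lambda>x. \<beta> (g x) w)" if "linear_map K X V g" "w \<in> carrier W"
    using assms that linear_map_comp[of K V U "\<lambda>v. \<beta> v w" X g] by (auto simp: bilinear_map_def)
  show "linear_map K X U (\<lambda>x. \<beta> v (h x))" if "linear_map K X W h" "v \<in> carrier V"
    using assms that linear_map_comp[of K W U "\<beta> v" X h] by (auto simp: bilinear_map_def)
  show "\<beta> v w \<in> carrier U" if "v \<in> carrier V" "w \<in> carrier W"
    using assms that linear_map_closed[of K W U "\<beta> v"] by (auto simp: bilinear_map_def)
qed

section \<open>Universal property of the tensor product\<close>

lemma tensor_null:
  assumes V: "vectorspace K V" and W: "vectorspace K W"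
  shows tensor_free_vectorspace: "vectorspace K (tensor_free K V W)"
    and tensor_gen_closed: "v \<in> carrier V \<Longrightarrow> w \<in> carrier W \<Longrightarrow> tensor_gen K V W v w \<in> carrier (tensor_free K V W)"
    and tensor_null_submodule: "LinearCombinations.submodule K (tensor_null K V W) (tensor_free K V W)"
    and tensor_relations_null: "tensor_relations K V W \<subseteq> tensor_null K V W"
proof -
  interpret V: vectorspace K V by fact
  interpret W: vectorspace K W by fact
  show F: "vectorspace K (tensor_free K V W)"
    unfolding tensor_free_def by (rule free_module_vectorspace[OF V.field_axioms])
  interpret F: vectorspace K "tensor_free K V W" by (rule F)
  show gen: "tensor_gen K V W v w \<in> carrier (tensor_free K V W)"
    if "v \<in> carrier V" "w \<in> carrier W" for v w
    unfolding tensor_free_def using that by (intro free_gen_closed[OF V.field_axioms]) auto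
  have rel: "tensor_relations K V W \<subseteq> carrier (tensor_free K V W)"
    unfolding tensor_relations_def Let_def
    by (auto intro!: F.M.minus_closed F.M.add.m_closed gen F.smult_closed
        V.M.add.m_closed W.M.add.m_closed V.smult_closed W.smult_closed)
  show "LinearCombinations.submodule K (tensor_null K V W) (tensor_free K V W)"
    unfolding tensor_null_def by (rule F.span_is_submodule[OF rel])
  show "tensor_relations K V W \<subseteq> tensor_null K V W"
    unfolding tensor_null_def by (rule F.in_own_span[OF rel])
qed

lemma tensor_vectorspace:
  "vectorspace K V \<Longrightarrow> vectorspace K W \<Longrightarrow> vectorspace K (tensor K V W)"
  unfolding tensor_def by (rule quotient_vectorspace[OF tensor_free_vectorspace tensor_null_submodule])

lemma tensor_proj_linear:
  "vectorspace K V \<Longrightarrow> vectorspace K W \<Longrightarrow>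
    linear_map K (tensor_free K V W) (tensor K V W) (\<lambda>x. tensor_null K V W +>\<^bsub>tensor_free K V W\<^esub> x)"
  unfolding tensor_def by (rule quotient_linear[OF tensor_free_vectorspace tensor_null_submodule])

lemma tensor_proj_eq:
  assumes V: "vectorspace K V" and W: "vectorspace K W"
    and x: "x \<in> carrier (tensor_free K V W)" and y: "y \<in> carrier (tensor_free K V W)"
    and r: "x \<ominus>\<^bsub>tensor_free K V W\<^esub> y \<in> tensor_null K V W"
  shows "tensor_null K V W +>\<^bsub>tensor_free K V W\<^esub> x = tensor_null K V W +>\<^bsub>tensor_free K V W\<^esub> y"
  by (rule quotient_coset_eq[OF tensor_free_vectorspace[OF V W] tensor_null_submodule[OF V W] y x r, symmetric])

text \<open>Each of the four families in \<open>tensor_relations\<close> is the defect of one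
  bilinearity condition, and the projection to the quotient kills it.\<close>

lemma pure_tensor_bilinear:
  assumes V: "vectorspace K V" and W: "vectorspace K W"
  shows "bilinear_map K V W (tensor K V W) (pure_tensor K V W)"
proof -
  interpret V: vectorspace K V by fact
  interpret W: vectorspace K W by fact
  let ?F = "tensor_free K V W" and ?p = "\<lambda>x. tensor_null K V W +>\<^bsub>tensor_free K V W\<^esub> x"
  interpret F: vectorspace K ?F by (rule tensor_free_vectorspace[OF V W])
  note T = tensor_vectorspace[OF V W]
  note p = tensor_proj_linear[OF V W]
  note gen = tensor_gen_closed[OF V W]
  note eq = tensor_proj_eq[OF V W _ _ subsetD[OF tensor_relations_null[OF V W]]]
  have c: "pure_tensor K V W v w \<in> carrier (tensor K V W)" if "v \<in> carrier V" "w \<in> carrier W" for v w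
    unfolding pure_tensor_def by (rule linear_map_closed[OF p gen[OF that]])
  have 1: "pure_tensor K V W v (w \<oplus>\<^bsub>W\<^esub> w') =
      pure_tensor K V W v w \<oplus>\<^bsub>tensor K V W\<^esub> pure_tensor K V W v w'"
    if h: "v \<in> carrier V" "w \<in> carrier W" "w' \<in> carrier W" for v w w'
    unfolding pure_tensor_def
    by (subst linear_map_add[OF p, symmetric], (rule gen; use h in simp)+, rule eq)
      (use h in \<open>auto simp: tensor_relations_def Let_def intro!: gen F.M.add.m_closed\<close>)
  have 2: "pure_tensor K V W v (c \<odot>\<^bsub>W\<^esub> w) = c \<odot>\<^bsub>tensor K V W\<^esub> pure_tensor K V W v w"
    if h: "v \<in> carrier V" "w \<in> carrier W" "c \<in> carrier K" for v w c
    unfolding pure_tensor_def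
    by (subst linear_map_smult[OF p, symmetric], use h in simp, (rule gen; use h in simp), rule eq)
      (use h in \<open>auto simp: tensor_relations_def Let_def intro!: gen F.smult_closed\<close>)
  have 3: "pure_tensor K V W (v \<oplus>\<^bsub>V\<^esub> v') w =
      pure_tensor K V W v w \<oplus>\<^bsub>tensor K V W\<^esub> pure_tensor K V W v' w"
    if h: "v \<in> carrier V" "v' \<in> carrier V" "w \<in> carrier W" for v v' w
    unfolding pure_tensor_def
    by (subst linear_map_add[OF p, symmetric], (rule gen; use h in simp)+, rule eq)
      (use h in \<open>auto simp: tensor_relations_def Let_def intro!: gen F.M.add.m_closed\<close>)
  have 4: "pure_tensor K V W (c \<odot>\<^bsub>V\<^esub> v) w = c \<odot>\<^bsub>tensor K V W\<^esub> pure_tensor K V W v w"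
    if h: "v \<in> carrier V" "w \<in> carrier W" "c \<in> carrier K" for v w c
    unfolding pure_tensor_def
    by (subst linear_map_smult[OF p, symmetric], use h in simp, (rule gen; use h in simp), rule eq)
      (use h in \<open>auto simp: tensor_relations_def Let_def intro!: gen F.smult_closed\<close>)
  show ?thesis
    by (rule bilinear_mapI[OF V W]; rule linear_mapI[OF _ T]) (auto simp: V W c 1 2 3 4)
qed

lemmas pure_tensor_closed = bilinear_closed[OF pure_tensor_bilinear]

text \<open>Composing with the projection gives linear maps on the free module, where agreement on
  generators suffices. Most identities on tensor products below are reduced to pure tensors in this
  way.\<close>

lemma tensor_ext:
  assumes f: "linear_map K (tensor K V W) U f" and g: "linear_map K (tensor K V W) U g"
    and V: "vectorspace K V" and W: "vectorspace K W"
    and eq: "\<And>v w. v \<in> carrier V \<Longrightarrow> w \<in> carrier W \<Longrightarrow> f (pure_tensor K V W v w) = g (pure_tensor K V W v w)"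
    and t: "t \<in> carrier (tensor K V W)"
  shows "f t = g t"
proof -
  let ?F = "tensor_free K V W" and ?p = "\<lambda>x. tensor_null K V W +>\<^bsub>tensor_free K V W\<^esub> x"
  note p = tensor_proj_linear[OF V W]
  obtain x where x: "x \<in> carrier ?F" "t = ?p x"
    using quotient_carrierE[OF tensor_free_vectorspace[OF V W] tensor_null_submodule[OF V W]] t
    unfolding tensor_def by blast
  have "f (?p x) = g (?p x)"
    by (rule free_module_linear_ext[OF linear_map_comp[OF f p, unfolded tensor_free_def]
          linear_map_comp[OF g p, unfolded tensor_free_def], folded tensor_free_def])
      (use eq x(1) in \<open>auto simp: pure_tensor_def\<close>)
  then show ?thesis using x by simp
qed

text \<open>The linear extension \<open>?\<Phi>\<close> of \<open>\<beta>\<close> vanishes on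
  \<open>tensor_null\<close>, hence is constant on each coset; this is why \<open>the_elem\<close>
  in the definition of \<open>tensor_lift\<close> meets a singleton.\<close>

lemma tensor_lift:
  assumes b: "bilinear_map K V W U \<beta>"
  shows tensor_lift_linear: "linear_map K (tensor K V W) U (tensor_lift K V W U \<beta>)"
    and tensor_lift_pure: "v \<in> carrier V \<Longrightarrow> w \<in> carrier W \<Longrightarrow>
      tensor_lift K V W U \<beta> (pure_tensor K V W v w) = \<beta> v w"
proof -
  have V: "vectorspace K V" and W: "vectorspace K W" and U: "vectorspace K U"
    using b by (auto simp: bilinear_map_def)
  interpret V: vectorspace K V by fact
  interpret W: vectorspace K W by fact
  interpret U: vectorspace K U by fact
  let ?F = "tensor_free K V W" and ?p = "\<lambda>x. tensor_null K V W +>\<^bsub>tensor_free K V W\<^esub> x"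
  let ?\<Phi> = "free_lift K (carrier V \<times> carrier W) U (\<lambda>p. \<beta> (fst p) (snd p))"
  interpret F: vectorspace K ?F by (rule tensor_free_vectorspace[OF V W])
  have bc: "(\<lambda>p. \<beta> (fst p) (snd p)) \<in> carrier V \<times> carrier W \<rightarrow> carrier U"
    using bilinear_closed[OF b] by auto
  note gen = tensor_gen_closed[OF V W]
  have \<Phi>: "linear_map K ?F U ?\<Phi>"
    unfolding tensor_free_def by (rule free_lift_linear[OF U bc])
  have \<Phi>g: "?\<Phi> (tensor_gen K V W v w) = \<beta> v w" if "v \<in> carrier V" "w \<in> carrier W" for v w
    using free_lift_gen[OF U bc, of "(v, w)"] that by simp
  interpret \<Phi>: linear_map K ?F U ?\<Phi> by (rule \<Phi>)
  have b1: "linear_map K W U (\<beta> v)" if "v \<in> carrier V" for v using b that by (auto simp: bilinear_map_def)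
  have b2: "linear_map K V U (\<lambda>v. \<beta> v w)" if "w \<in> carrier W" for w using b that by (auto simp: bilinear_map_def)
  \<comment> \<open>On each relation the two sides cancel by bilinearity. The kernel is a submodule,
    so it then contains the whole span.\<close>
  have "tensor_relations K V W \<subseteq> \<Phi>.ker"
    unfolding tensor_relations_def Let_def \<Phi>.ker_def
    by (auto simp: gen \<Phi>g U.M.minus_eq U.M.r_neg bilinear_closed[OF b]
        linear_map_add[OF b1] linear_map_add[OF b2] linear_map_smult[OF b1] linear_map_smult[OF b2])
  then have ker: "?\<Phi> n = \<zero>\<^bsub>U\<^esub>" if "n \<in> tensor_null K V W" for n
    using F.span_is_subset[OF _ \<Phi>.ker_is_submodule] that
    unfolding tensor_null_def \<Phi>.ker_def by auto
  have lift: "tensor_lift K V W U \<beta> (?p x) = ?\<Phi> x" if x: "x \<in> carrier ?F" for x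
  proof -
    have "?\<Phi> y = ?\<Phi> x" if y: "y \<in> ?p x" for y
    proof -
      have y': "y \<in> carrier ?F" "y \<ominus>\<^bsub>?F\<^esub> x \<in> tensor_null K V W"
        using quotient_mem_cosetD[OF F.vectorspace_axioms tensor_null_submodule[OF V W] x y] by auto
      have "?\<Phi> y \<ominus>\<^bsub>U\<^esub> ?\<Phi> x = \<zero>\<^bsub>U\<^esub>" using ker[OF y'(2)] x y'(1) by simp
      then show ?thesis using linear_map_closed[OF \<Phi>] x y'(1) by simp
    qed
    moreover have "x \<in> ?p x"
      by (rule quotient_mem_coset[OF F.vectorspace_axioms tensor_null_submodule[OF V W] x])
    ultimately have "?\<Phi> ` ?p x = {?\<Phi> x}" by blast
    then show ?thesis by (simp add: tensor_lift_def)
  qed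
  show "tensor_lift K V W U \<beta> (pure_tensor K V W v w) = \<beta> v w"
    if "v \<in> carrier V" "w \<in> carrier W"
    unfolding pure_tensor_def lift[OF gen[OF that]] by (rule \<Phi>g[OF that])
  have E: "\<exists>x\<in>carrier ?F. t = ?p x" if "t \<in> carrier (tensor K V W)" for t
    using quotient_carrierE[OF tensor_free_vectorspace[OF V W] tensor_null_submodule[OF V W]] that
    unfolding tensor_def by blast
  note p = tensor_proj_linear[OF V W]
  show "linear_map K (tensor K V W) U (tensor_lift K V W U \<beta>)"
    by (rule linear_mapI[OF tensor_vectorspace[OF V W] U])
      (auto dest!: E simp: lift linear_map_closed[OF \<Phi>] linear_map_add[OF p, symmetric]
        linear_map_smult[OF p, symmetric])
qed

text \<open>\<open>lin\<close> collects the rules that discharge linearity and closure side conditions. Their scalar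
  premises read \<open>c \<in> carrier (ground K)\<close>, because as values of linear maps scalars are elements of
  the module \<open>ground K\<close>.\<close>

named_theorems lin

lemmas [lin] = tensor_vectorspace linear_map_id pure_tensor_closed

lemma tensor_lift_closed [lin]:
  "bilinear_map K V W U \<beta> \<Longrightarrow> t \<in> carrier (tensor K V W) \<Longrightarrow> tensor_lift K V W U \<beta> t \<in> carrier U"
  by (rule linear_map_closed[OF tensor_lift_linear])

lemma bilinear_map_iff_linear [lin]:
  assumes "vectorspace K V" "vectorspace K W"
    and "\<And>v. v \<in> carrier V \<Longrightarrow> linear_map K W U (\<lambda>w. \<beta> v w)"
    and "\<And>w. w \<in> carrier W \<Longrightarrow> linear_map K V U (\<lambda>v. \<beta> v w)"
  shows "bilinear_map K V W U \<beta>"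
  using assms by (rule bilinear_mapI)

lemma pure_tensor_linear [lin]:
  assumes "vectorspace K V" "vectorspace K W"
  shows "linear_map K X V g \<Longrightarrow> w \<in> carrier W \<Longrightarrow> linear_map K X (tensor K V W) (\<lambda>x. pure_tensor K V W (g x) w)"
    and "linear_map K X W h \<Longrightarrow> v \<in> carrier V \<Longrightarrow> linear_map K X (tensor K V W) (\<lambda>x. pure_tensor K V W v (h x))"
  using bilinear_left[OF pure_tensor_bilinear[OF assms]] bilinear_right[OF pure_tensor_bilinear[OF assms]]
  by auto

lemma tensor_lift_linear_comp [lin]:
  "bilinear_map K V W U \<beta> \<Longrightarrow> linear_map K X (tensor K V W) g \<Longrightarrow>
    linear_map K X U (\<lambda>x. tensor_lift K V W U \<beta> (g x))"
  by (rule linear_map_comp[OF tensor_lift_linear])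

lemma linear_map_add_fun:
  assumes f: "linear_map K V W f" and g: "linear_map K V W g"
  shows "linear_map K V W (\<lambda>x. f x \<oplus>\<^bsub>W\<^esub> g x)"
proof -
  interpret V: vectorspace K V by (rule linear_map_dom[OF f])
  interpret W: vectorspace K W by (rule linear_map_cod[OF f])
  show ?thesis
    by (rule linear_mapI[OF V.vectorspace_axioms W.vectorspace_axioms])
      (auto simp: linear_map_closed[OF f] linear_map_closed[OF g] linear_map_add[OF f] linear_map_add[OF g]
        linear_map_smult[OF f] linear_map_smult[OF g] W.M.add.m_ac W.smult_r_distr)
qed

lemma linear_map_smult_fun:
  assumes f: "linear_map K V W f" and c: "c \<in> carrier K"
  shows "linear_map K V W (\<lambda>x. c \<odot>\<^bsub>W\<^esub> f x)"
proof -
  interpret V: vectorspace K V by (rule linear_map_dom[OF f])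
  interpret W: vectorspace K W by (rule linear_map_cod[OF f])
  have fieldD: "cring K" by unfold_locales
  show ?thesis
    by (rule linear_mapI[OF V.vectorspace_axioms W.vectorspace_axioms])
      (auto simp: c linear_map_closed[OF f] linear_map_add[OF f] linear_map_smult[OF f]
        W.smult_r_distr W.smult_assoc1[symmetric] cring.cring_simprules(14)[OF fieldD])
qed

text \<open>Both sides of each linearity condition are linear in \<open>t\<close>, so pure tensors
  decide it. Nested lifts need this rule, since there the inner bilinear map depends on an outer
  variable.\<close>

lemma tensor_lift_linear_param [lin]:
  assumes b: "\<And>x. x \<in> carrier X \<Longrightarrow> bilinear_map K V W U (\<beta> x)"
    and l: "\<And>v w. v \<in> carrier V \<Longrightarrow> w \<in> carrier W \<Longrightarrow> linear_map K X U (\<lambda>x. \<beta> x v w)"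
    and t: "t \<in> carrier (tensor K V W)" and V: "vectorspace K V" and W: "vectorspace K W"
  shows "linear_map K X U (\<lambda>x. tensor_lift K V W U (\<beta> x) t)"
proof -
  interpret V: vectorspace K V by fact
  interpret W: vectorspace K W by fact
  note l0 = l[OF V.M.zero_closed W.M.zero_closed]
  interpret X: vectorspace K X by (rule linear_map_dom[OF l0])
  have U: "vectorspace K U" by (rule linear_map_cod[OF l0])
  show ?thesis
  proof (rule linear_mapI[OF X.vectorspace_axioms U])
    show "tensor_lift K V W U (\<beta> x) t \<in> carrier U" if "x \<in> carrier X" for x
      using b[OF that] t by (rule tensor_lift_closed)
    show "tensor_lift K V W U (\<beta> (x \<oplus>\<^bsub>X\<^esub> y)) t =
        tensor_lift K V W U (\<beta> x) t \<oplus>\<^bsub>U\<^esub> tensor_lift K V W U (\<beta> y) t"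
      if h: "x \<in> carrier X" "y \<in> carrier X" for x y
      by (rule tensor_ext[OF tensor_lift_linear linear_map_add_fun[OF tensor_lift_linear tensor_lift_linear] V W _ t])
        (use h in \<open>auto simp: b tensor_lift_pure linear_map_add[OF l]\<close>)
    show "tensor_lift K V W U (\<beta> (c \<odot>\<^bsub>X\<^esub> x)) t = c \<odot>\<^bsub>U\<^esub> tensor_lift K V W U (\<beta> x) t"
      if h: "c \<in> carrier K" "x \<in> carrier X" for c x
      by (rule tensor_ext[OF tensor_lift_linear linear_map_smult_fun[OF tensor_lift_linear] V W _ t])
        (use h in \<open>auto simp: b tensor_lift_pure linear_map_smult[OF l]\<close>)
  qed
qed

section \<open>Tensor products of maps and canonical isomorphisms\<close>

lemma tensor_map_linear [lin]:
  assumes f: "linear_map K V V' f" and g: "linear_map K W W' g"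
  shows "linear_map K X (tensor K V W) h \<Longrightarrow> linear_map K X (tensor K V' W') (\<lambda>x. tensor_map K V W V' W' f g (h x))"
    and "t \<in> carrier (tensor K V W) \<Longrightarrow> tensor_map K V W V' W' f g t \<in> carrier (tensor K V' W')"
    and tensor_map_pure: "v \<in> carrier V \<Longrightarrow> w \<in> carrier W \<Longrightarrow>
      tensor_map K V W V' W' f g (pure_tensor K V W v w) = pure_tensor K V' W' (f v) (g w)"
proof -
  note vs = linear_map_dom[OF f] linear_map_dom[OF g] linear_map_cod[OF f] linear_map_cod[OF g]
  have b: "bilinear_map K V W (tensor K V' W') (\<lambda>v w. pure_tensor K V' W' (f v) (g w))"
    by (simp add: lin vs f g linear_map_closed[OF f] linear_map_closed[OF g])
  show "linear_map K X (tensor K V W) h \<Longrightarrow> linear_map K X (tensor K V' W') (\<lambda>x. tensor_map K V W V' W' f g (h x))"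
    "t \<in> carrier (tensor K V W) \<Longrightarrow> tensor_map K V W V' W' f g t \<in> carrier (tensor K V' W')"
    unfolding tensor_map_def using b by (simp_all add: lin)
  show "v \<in> carrier V \<Longrightarrow> w \<in> carrier W \<Longrightarrow>
      tensor_map K V W V' W' f g (pure_tensor K V W v w) = pure_tensor K V' W' (f v) (g w)"
    unfolding tensor_map_def by (rule tensor_lift_pure[OF b])
qed

lemma tassoc_linear [lin]:
  assumes U: "vectorspace K U" and V: "vectorspace K V" and W: "vectorspace K W"
  shows "linear_map K X (tensor K (tensor K U V) W) h \<Longrightarrow>
      linear_map K X (tensor K U (tensor K V W)) (\<lambda>x. tassoc K U V W (h x))"
    and "t \<in> carrier (tensor K (tensor K U V) W) \<Longrightarrow> tassoc K U V W t \<in> carrier (tensor K U (tensor K V W))"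
    and tassoc_pure: "u \<in> carrier U \<Longrightarrow> v \<in> carrier V \<Longrightarrow> w \<in> carrier W \<Longrightarrow>
      tassoc K U V W (pure_tensor K (tensor K U V) W (pure_tensor K U V u v) w)
        = pure_tensor K U (tensor K V W) u (pure_tensor K V W v w)"
  unfolding tassoc_def by (simp_all add: lin U V W tensor_lift_pure)

lemma tassoc_inv_linear [lin]:
  assumes U: "vectorspace K U" and V: "vectorspace K V" and W: "vectorspace K W"
  shows "linear_map K X (tensor K U (tensor K V W)) h \<Longrightarrow>
      linear_map K X (tensor K (tensor K U V) W) (\<lambda>x. tassoc_inv K U V W (h x))"
    and "t \<in> carrier (tensor K U (tensor K V W)) \<Longrightarrow> tassoc_inv K U V W t \<in> carrier (tensor K (tensor K U V) W)"
    and tassoc_inv_pure: "u \<in> carrier U \<Longrightarrow> v \<in> carrier V \<Longrightarrow> w \<in> carrier W \<Longrightarrow>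
      tassoc_inv K U V W (pure_tensor K U (tensor K V W) u (pure_tensor K V W v w))
        = pure_tensor K (tensor K U V) W (pure_tensor K U V u v) w"
  unfolding tassoc_inv_def by (simp_all add: lin U V W tensor_lift_pure)

lemma carrier_ground: "carrier (ground K) = carrier K"
  and one_ground [simp]: "\<one>\<^bsub>ground K\<^esub> = \<one>\<^bsub>K\<^esub>"
  and smult_ground [simp]: "c \<odot>\<^bsub>ground K\<^esub> d = c \<otimes>\<^bsub>K\<^esub> d"
  and add_ground [simp]: "c \<oplus>\<^bsub>ground K\<^esub> d = c \<oplus>\<^bsub>K\<^esub> d"
  and zero_ground [simp]: "\<zero>\<^bsub>ground K\<^esub> = \<zero>\<^bsub>K\<^esub>"
  by (simp_all add: ground_def)

lemma ground_vectorspace: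
  assumes "vectorspace K V"
  shows "vectorspace K (ground K)"
proof -
  interpret V: vectorspace K V by fact
  have "module K (ground K)"
    by (rule module_criteria)
      (auto simp: carrier_ground V.R.add.m_ac V.R.m_assoc V.R.l_distr V.R.r_distr V.is_cring intro: bexI[of _ "\<ominus>\<^bsub>K\<^esub> _"] V.R.r_neg)
  then show ?thesis unfolding vectorspace_def using V.field_axioms by auto
qed

lemma smult_linear [lin]:
  assumes "vectorspace K V"
  shows "linear_map K X (ground K) g \<Longrightarrow> v \<in> carrier V \<Longrightarrow> linear_map K X V (\<lambda>x. g x \<odot>\<^bsub>V\<^esub> v)"
    and "c \<in> carrier (ground K) \<Longrightarrow> linear_map K X V h \<Longrightarrow> linear_map K X V (\<lambda>x. c \<odot>\<^bsub>V\<^esub> h x)"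
    and "c \<in> carrier (ground K) \<Longrightarrow> v \<in> carrier V \<Longrightarrow> c \<odot>\<^bsub>V\<^esub> v \<in> carrier V"
proof -
  interpret V: vectorspace K V by fact
  have "linear_map K (ground K) V (\<lambda>c. c \<odot>\<^bsub>V\<^esub> v)" if "v \<in> carrier V" for v
    by (rule linear_mapI[OF ground_vectorspace]) (use that assms in \<open>auto simp: carrier_ground V.smult_l_distr V.smult_assoc1\<close>)
  then show "linear_map K X (ground K) g \<Longrightarrow> v \<in> carrier V \<Longrightarrow> linear_map K X V (\<lambda>x. g x \<odot>\<^bsub>V\<^esub> v)"
    using linear_map_comp[of K "ground K" V _ X g] by blast
qed (auto simp: carrier_ground intro: linear_map_smult_fun module.smult_closed[OF vectorspace.axioms(1)[OF assms]])

lemma unit_isos: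
  assumes V: "vectorspace K V"
  shows lunit_linear [lin]: "linear_map K X (tensor K (ground K) V) h \<Longrightarrow> linear_map K X V (\<lambda>x. lunit K V (h x))"
    and runit_linear [lin]: "linear_map K X (tensor K V (ground K)) h' \<Longrightarrow> linear_map K X V (\<lambda>x. runit K V (h' x))"
    and lunit_pure: "c \<in> carrier (ground K) \<Longrightarrow> v \<in> carrier V \<Longrightarrow> lunit K V (pure_tensor K (ground K) V c v) = c \<odot>\<^bsub>V\<^esub> v"
    and runit_pure: "c \<in> carrier (ground K) \<Longrightarrow> v \<in> carrier V \<Longrightarrow> runit K V (pure_tensor K V (ground K) v c) = c \<odot>\<^bsub>V\<^esub> v"
  using V ground_vectorspace[OF V] unfolding lunit_def runit_def
  by (simp_all add: lin tensor_lift_pure)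

text \<open>The value of \<open>\<sigma>\<close> at a pure tensor need not be pure. With
  \<open>\<sigma>(y \<otimes> x) = \<Sum> z \<otimes> z'\<close>, the lift stands for
  \<open>\<Sum> (p \<otimes> z) \<otimes> (z' \<otimes> q)\<close>.\<close>

lemma mid_map:
  assumes P: "vectorspace K P" and Q: "vectorspace K Q"
    and s: "linear_map K (tensor K Y X) (tensor K Z Z') \<sigma>"
    and X: "vectorspace K X" and Y: "vectorspace K Y" and Z: "vectorspace K Z" and Z': "vectorspace K Z'"
  shows mid_map_linear: "linear_map K (tensor K (tensor K P Y) (tensor K X Q)) (tensor K (tensor K P Z) (tensor K Z' Q))
        (mid_map K P Y X Z Z' Q \<sigma>)"
    and mid_map_pure: "p \<in> carrier P \<Longrightarrow> y \<in> carrier Y \<Longrightarrow> x \<in> carrier X \<Longrightarrow> q \<in> carrier Q \<Longrightarrow>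
      mid_map K P Y X Z Z' Q \<sigma> (pure_tensor K (tensor K P Y) (tensor K X Q) (pure_tensor K P Y p y) (pure_tensor K X Q x q))
      = tensor_lift K Z Z' (tensor K (tensor K P Z) (tensor K Z' Q))
          (\<lambda>z z'. pure_tensor K (tensor K P Z) (tensor K Z' Q) (pure_tensor K P Z p z) (pure_tensor K Z' Q z' q))
          (\<sigma> (pure_tensor K Y X y x))"
proof -
  note vs = P Q X Y Z Z'
  note [lin] = linear_map_comp[OF s] linear_map_closed[OF s]
  let ?inner = "tassoc K Z Z' Q \<circ> tensor_map K (tensor K Y X) Q (tensor K Z Z') Q \<sigma> id \<circ> tassoc_inv K Y X Q"
  have inner: "linear_map K (tensor K Y (tensor K X Q)) (tensor K Z (tensor K Z' Q)) ?inner"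
    by (simp add: comp_def id_def lin vs s)
  then show "linear_map K (tensor K (tensor K P Y) (tensor K X Q)) (tensor K (tensor K P Z) (tensor K Z' Q))
        (mid_map K P Y X Z Z' Q \<sigma>)"
    unfolding mid_map_def by (simp add: comp_def id_def lin vs)
  assume h: "p \<in> carrier P" "y \<in> carrier Y" "x \<in> carrier X" "q \<in> carrier Q"
  define t where "t = \<sigma> (pure_tensor K Y X y x)"
  have t: "t \<in> carrier (tensor K Z Z')" unfolding t_def by (simp add: lin vs h)
  \<comment> \<open>Both sides are linear in \<open>t\<close>, so the value of
    \<open>\<sigma>\<close> may be replaced by a pure tensor, on which the associators are
    known.\<close>
  have "tassoc_inv K P Z (tensor K Z' Q) (pure_tensor K P (tensor K Z (tensor K Z' Q)) p
      (tassoc K Z Z' Q (pure_tensor K (tensor K Z Z') Q t q)))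
    = tensor_lift K Z Z' (tensor K (tensor K P Z) (tensor K Z' Q))
          (\<lambda>z z'. pure_tensor K (tensor K P Z) (tensor K Z' Q) (pure_tensor K P Z p z) (pure_tensor K Z' Q z' q)) t"
    by (rule tensor_ext[OF _ _ Z Z' _ t, where U = "tensor K (tensor K P Z) (tensor K Z' Q)"])
      (simp_all add: lin vs h tassoc_pure tassoc_inv_pure tensor_lift_pure)
  then show "mid_map K P Y X Z Z' Q \<sigma> (pure_tensor K (tensor K P Y) (tensor K X Q) (pure_tensor K P Y p y) (pure_tensor K X Q x q))
      = tensor_lift K Z Z' (tensor K (tensor K P Z) (tensor K Z' Q))
          (\<lambda>z z'. pure_tensor K (tensor K P Z) (tensor K Z' Q) (pure_tensor K P Z p z) (pure_tensor K Z' Q z' q))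
          (\<sigma> (pure_tensor K Y X y x))"
    unfolding mid_map_def
    by (simp add: comp_def id_def tassoc_pure tassoc_inv_pure tensor_map_pure lin vs h
        tensor_map_pure[OF linear_map_id inner[unfolded comp_def id_def]] s t_def)
qed

lemma linear_map_id' [lin]: "vectorspace K V \<Longrightarrow> linear_map K V V id"
  by (simp add: id_def lin)

section \<open>Algebras on elements\<close>

context k_algebra
begin

abbreviation mul where "mul x y \<equiv> nabla (pure_tensor K A A x y)"

abbreviation unt where "unt \<equiv> eta \<one>\<^bsub>K\<^esub>"

lemma vs [lin]: "vectorspace K A" "vectorspace K (ground K)"
  using vectorspace_axioms by (auto intro: ground_vectorspace)

lemmas smult_closed_ground [lin] = smult_linear(3)[OF vs(1)]

lemmas nabla_lin [lin] = linear_map_comp[OF nabla_linear] linear_map_closed[OF nabla_linear]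

lemma unt_closed [lin]: "unt \<in> carrier A"
  by (rule linear_map_closed[OF eta_linear]) (simp add: carrier_ground)

lemma one_ground_closed [lin]: "\<one>\<^bsub>K\<^esub> \<in> carrier (ground K)"
  by (simp add: carrier_ground)

lemma mul_assoc:
  "a \<in> carrier A \<Longrightarrow> b \<in> carrier A \<Longrightarrow> c \<in> carrier A \<Longrightarrow> mul (mul a b) c = mul a (mul b c)"
  using assoc[of "pure_tensor K (tensor K A A) A (pure_tensor K A A a b) c"]
  by (simp add: lin tensor_map_pure tassoc_pure nabla_linear)

lemma mul_unt_left: "a \<in> carrier A \<Longrightarrow> mul unt a = a"
  using unit_left[of "pure_tensor K (ground K) A \<one>\<^bsub>K\<^esub> a"]
  by (simp add: lin tensor_map_pure lunit_pure eta_linear smult_one)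

lemma mul_unt_right: "a \<in> carrier A \<Longrightarrow> mul a unt = a"
  using unit_right[of "pure_tensor K A (ground K) a \<one>\<^bsub>K\<^esub>"]
  by (simp add: lin tensor_map_pure runit_pure eta_linear smult_one)

end

text \<open>Pure tensors suffice for all three laws, and \<open>eta c = c eta(1)\<close> reduces the
  unit laws to the element \<open>eta(1)\<close>.\<close>

lemma k_algebraI:
  assumes V: "vectorspace K A"
    and nabla: "linear_map K (tensor K A A) A nabla" and eta: "linear_map K (ground K) A eta"
    and assoc: "\<And>a b c. a \<in> carrier A \<Longrightarrow> b \<in> carrier A \<Longrightarrow> c \<in> carrier A \<Longrightarrow>
        nabla (pure_tensor K A A (nabla (pure_tensor K A A a b)) c)
      = nabla (pure_tensor K A A a (nabla (pure_tensor K A A b c)))"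
    and unit_left: "\<And>a. a \<in> carrier A \<Longrightarrow> nabla (pure_tensor K A A (eta \<one>\<^bsub>K\<^esub>) a) = a"
    and unit_right: "\<And>a. a \<in> carrier A \<Longrightarrow> nabla (pure_tensor K A A a (eta \<one>\<^bsub>K\<^esub>)) = a"
  shows "k_algebra K A nabla eta"
proof -
  interpret A: vectorspace K A by fact
  note vs = V ground_vectorspace[OF V]
  note [lin] = linear_map_comp[OF nabla] linear_map_closed[OF nabla] linear_map_comp[OF eta] linear_map_closed[OF eta]
  have one: "\<one>\<^bsub>K\<^esub> \<in> carrier (ground K)" by (simp add: carrier_ground)
  have eta_c: "eta c = c \<odot>\<^bsub>A\<^esub> eta \<one>\<^bsub>K\<^esub>" if "c \<in> carrier (ground K)" for c
    using linear_map_smult[OF eta _ one, of c] that by (simp add: carrier_ground)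
  have sl: "nabla (pure_tensor K A A (c \<odot>\<^bsub>A\<^esub> a) b) = c \<odot>\<^bsub>A\<^esub> nabla (pure_tensor K A A a b)"
    if "c \<in> carrier (ground K)" "a \<in> carrier A" "b \<in> carrier A" for a b c
    by (rule linear_map_smult[of K A A "\<lambda>a. nabla (pure_tensor K A A a b)"])
      (use that in \<open>simp_all add: lin vs carrier_ground\<close>)
  have sr: "nabla (pure_tensor K A A b (c \<odot>\<^bsub>A\<^esub> a)) = c \<odot>\<^bsub>A\<^esub> nabla (pure_tensor K A A b a)"
    if "c \<in> carrier (ground K)" "a \<in> carrier A" "b \<in> carrier A" for a b c
    by (rule linear_map_smult[of K A A "\<lambda>a. nabla (pure_tensor K A A b a)"])
      (use that in \<open>simp_all add: lin vs carrier_ground\<close>)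
  show ?thesis
  proof (intro k_algebra.intro[OF V] k_algebra_axioms.intro, rule nabla, rule eta)
    show "(nabla \<circ> tensor_map K (tensor K A A) A A A nabla id) x
        = (nabla \<circ> tensor_map K A (tensor K A A) A A id nabla \<circ> tassoc K A A A) x"
      if x: "x \<in> carrier (tensor K (tensor K A A) A)" for x
    proof (rule tensor_ext[OF _ _ _ _ _ x, where U = A])
      fix y c assume y: "y \<in> carrier (tensor K A A)" and c: "c \<in> carrier A"
      show "(nabla \<circ> tensor_map K (tensor K A A) A A A nabla id) (pure_tensor K (tensor K A A) A y c)
        = (nabla \<circ> tensor_map K A (tensor K A A) A A id nabla \<circ> tassoc K A A A) (pure_tensor K (tensor K A A) A y c)"
      proof (rule tensor_ext[OF _ _ V V _ y, where U = A])
        fix a b assume h: "a \<in> carrier A" "b \<in> carrier A"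
        show "(nabla \<circ> tensor_map K (tensor K A A) A A A nabla id)
            (pure_tensor K (tensor K A A) A (pure_tensor K A A a b) c)
          = (nabla \<circ> tensor_map K A (tensor K A A) A A id nabla \<circ> tassoc K A A A)
            (pure_tensor K (tensor K A A) A (pure_tensor K A A a b) c)"
          using h by (simp add: lin vs c nabla tensor_map_pure tassoc_pure assoc)
      qed (simp_all add: lin vs c nabla)
    qed (simp_all add: comp_def lin vs nabla)
    show "(nabla \<circ> tensor_map K (ground K) A A A eta id) x = lunit K A x"
      if x: "x \<in> carrier (tensor K (ground K) A)" for x
    proof (rule tensor_ext[OF _ _ _ _ _ x, where U = A])
      fix c a assume h: "c \<in> carrier (ground K)" "a \<in> carrier A"
      show "(nabla \<circ> tensor_map K (ground K) A A A eta id) (pure_tensor K (ground K) A c a)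
          = lunit K A (pure_tensor K (ground K) A c a)"
        using h by (simp add: lin vs eta tensor_map_pure lunit_pure eta_c[OF h(1)] sl one unit_left)
    qed (simp_all add: comp_def lin vs eta)
    show "(nabla \<circ> tensor_map K A (ground K) A A id eta) x = runit K A x"
      if x: "x \<in> carrier (tensor K A (ground K))" for x
    proof (rule tensor_ext[OF _ _ _ _ _ x, where U = A])
      fix a c assume h: "a \<in> carrier A" "c \<in> carrier (ground K)"
      show "(nabla \<circ> tensor_map K A (ground K) A A id eta) (pure_tensor K A (ground K) a c)
          = runit K A (pure_tensor K A (ground K) a c)"
        using h by (simp add: lin vs eta tensor_map_pure runit_pure eta_c[OF h(2)] sr one unit_right)
    qed (simp_all add: comp_def lin vs eta)
  qed
qed

section \<open>Twisted tensor products of algebras\<close>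

context twisting_map
begin

abbreviation R where "R \<equiv> tensor K A B"
abbreviation P where "P \<equiv> pure_tensor K A B"
abbreviation tw where "tw b a \<equiv> tau (pure_tensor K B A b a)"
abbreviation tmul where "tmul x y \<equiv> twisted_mult K A nablaA B nablaB tau (pure_tensor K R R x y)"

text \<open>\<open>act a b x\<close> is \<open>(a \<otimes> 1) x (1 \<otimes> b)\<close> in the twisted tensor product.\<close>

definition act where "act a b x = tensor_lift K A B R (\<lambda>p q. P (A.mul a p) (B.mul q b)) x"

lemmas tau_lin [lin] = linear_map_comp[OF tau_linear] linear_map_closed[OF tau_linear]

lemma act_lin [lin]:
  shows "linear_map K X A f \<Longrightarrow> b \<in> carrier B \<Longrightarrow> x \<in> carrier R \<Longrightarrow> linear_map K X R (\<lambda>t. act (f t) b x)"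
    and "linear_map K X B g \<Longrightarrow> a \<in> carrier A \<Longrightarrow> x \<in> carrier R \<Longrightarrow> linear_map K X R (\<lambda>t. act a (g t) x)"
    and "linear_map K X R h \<Longrightarrow> a \<in> carrier A \<Longrightarrow> b \<in> carrier B \<Longrightarrow> linear_map K X R (\<lambda>t. act a b (h t))"
    and "a \<in> carrier A \<Longrightarrow> b \<in> carrier B \<Longrightarrow> x \<in> carrier R \<Longrightarrow> act a b x \<in> carrier R"
    and act_pure: "a \<in> carrier A \<Longrightarrow> b \<in> carrier B \<Longrightarrow> p \<in> carrier A \<Longrightarrow> q \<in> carrier B \<Longrightarrow>
      act a b (P p q) = P (A.mul a p) (B.mul q b)"
  unfolding act_def by (simp_all add: lin tensor_lift_pure linear_map_closed[of K X A f] linear_map_closed[of K X B g])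

lemma act_act:
  assumes "a \<in> carrier A" "a' \<in> carrier A" "b \<in> carrier B" "b' \<in> carrier B" "x \<in> carrier R"
  shows "act a b (act a' b' x) = act (A.mul a a') (B.mul b' b) x"
  by (rule tensor_ext[OF _ _ A.vs(1) B.vs(1) _ assms(5), where U = R])
    (use assms in \<open>simp_all add: lin act_pure A.mul_assoc B.mul_assoc\<close>)

lemma act_unt: "x \<in> carrier R \<Longrightarrow> act A.unt B.unt x = x"
  by (rule tensor_ext[OF _ _ A.vs(1) B.vs(1), where U = R])
    (simp_all add: lin act_pure A.mul_unt_left B.mul_unt_right)

lemma twisted_mult_linear: "linear_map K (tensor K R R) R (twisted_mult K A nablaA B nablaB tau)"
  unfolding twisted_mult_def comp_def
  by (simp add: lin A.nabla_linear B.nabla_linear tau_linear linear_map_comp[OF mid_map_linear])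

lemmas tmul_lin [lin] = linear_map_comp[OF twisted_mult_linear] linear_map_closed[OF twisted_mult_linear]

text \<open>The product \<open>a b a' b'\<close> is computed by twisting only the inner pair
  \<open>b a'\<close>; the outer factors \<open>a\<close> and \<open>b'\<close> then act on the
  resulting sum.\<close>

lemma tmul_pure:
  assumes h: "a \<in> carrier A" "b \<in> carrier B" "a' \<in> carrier A" "b' \<in> carrier B"
  shows "tmul (P a b) (P a' b') = act a b' (tw b a')"
proof -
  have *: "tensor_map K (tensor K A A) (tensor K B B) A B nablaA nablaB
      (tensor_lift K A B (tensor K (tensor K A A) (tensor K B B))
        (\<lambda>z z'. pure_tensor K (tensor K A A) (tensor K B B) (pure_tensor K A A a z) (pure_tensor K B B z' b')) x)
    = act a b' x" if "x \<in> carrier R" for x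
    by (rule tensor_ext[OF _ _ A.vs(1) B.vs(1) _ that, where U = R])
      (simp_all add: lin h act_pure tensor_lift_pure tensor_map_pure A.nabla_linear B.nabla_linear)
  show ?thesis
    unfolding twisted_mult_def comp_def by (simp add: mid_map_pure lin h tau_linear *)
qed

section \<open>Associativity of the twisted product\<close>

text \<open>The two maps applied last in the twisting axiom together form the twisted
  multiplication. With \<open>\<tau>(b' \<otimes> a) = \<Sum> p \<otimes> q\<close>, the right side
  is thus \<open>\<Sum> \<tau>(b \<otimes> p) \<tau>(q \<otimes> a')\<close>.\<close>

lemma tw_mul:
  assumes h: "a \<in> carrier A" "b \<in> carrier B" "a' \<in> carrier A" "b' \<in> carrier B"
  shows "tw (B.mul b b') (A.mul a a') = tensor_lift K A B R (\<lambda>p q. tmul (tw b p) (tw q a')) (tw b' a)"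
proof -
  note l = A.nabla_linear B.nabla_linear tau_linear
  have *: "twisted_mult K A nablaA B nablaB tau
      (tensor_map K (tensor K B A) (tensor K B A) R R tau tau
       (tensor_lift K A B (tensor K (tensor K B A) (tensor K B A))
        (\<lambda>z z'. pure_tensor K (tensor K B A) (tensor K B A) (pure_tensor K B A b z) (pure_tensor K B A z' a')) x))
    = tensor_lift K A B R (\<lambda>p q. tmul (tw b p) (tw q a')) x" if "x \<in> carrier R" for x
    by (rule tensor_ext[OF _ _ A.vs(1) B.vs(1) _ that, where U = R])
      (simp_all add: lin h tensor_lift_pure tensor_map_pure l)
  show ?thesis
    using tau_mult[of "pure_tensor K (tensor K B B) (tensor K A A) (pure_tensor K B B b b') (pure_tensor K A A a a')"]
    by (simp add: lin h tensor_map_pure l mid_map_pure * twisted_mult_def[symmetric]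
        fun_cong[OF twisted_mult_def[unfolded comp_def], symmetric])
qed

text \<open>Taking a unit in \<open>tw_mul\<close> makes the inner twist a pure tensor, so the sum
  has one term. This lemma and \<open>tw_mul_right\<close> are the associativity cases
  \<open>(b b') a = b (b' a)\<close> and \<open>b (a a') = (b a) a'\<close>.\<close>

lemma tw_mul_left:
  assumes h: "a \<in> carrier A" "b \<in> carrier B" "b' \<in> carrier B"
  shows "tw (B.mul b b') a = tmul (P A.unt b) (tw b' a)"
  using tw_mul[OF A.unt_closed h(2,1,3)] h
  by (simp add: lin tau_unit_A tensor_lift_pure A.mul_unt_left)

lemma tw_mul_right:
  assumes h: "a \<in> carrier A" "a' \<in> carrier A" "b \<in> carrier B"
  shows "tw b (A.mul a a') = tmul (tw b a) (P a' B.unt)"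
  using tw_mul[OF h(1,3,2) B.unt_closed] h
  by (simp add: lin tau_unit_B tensor_lift_pure B.mul_unt_right)

text \<open>The factor \<open>p\<close> stands outermost on the left and never meets the twist, so
  it can be taken out of the product; \<open>tmul_right_pure\<close> is the mirror image.\<close>

lemma tmul_left_pure:
  assumes h: "p \<in> carrier A" "q \<in> carrier B" "x \<in> carrier R"
  shows "tmul (P p q) x = act p B.unt (tmul (P A.unt q) x)"
  by (rule tensor_ext[OF _ _ A.vs(1) B.vs(1) _ h(3), where U = R])
    (use h in \<open>simp_all add: lin tmul_pure act_act A.mul_unt_right B.mul_unt_right\<close>)

lemma tmul_right_pure:
  assumes h: "p \<in> carrier A" "q \<in> carrier B" "x \<in> carrier R"
  shows "tmul x (P p q) = act A.unt q (tmul x (P p B.unt))"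
  by (rule tensor_ext[OF _ _ A.vs(1) B.vs(1) _ h(3), where U = R])
    (use h in \<open>simp_all add: lin tmul_pure act_act A.mul_unt_left B.mul_unt_left\<close>)

text \<open>In product notation this is \<open>(a x b') (a'' b'') = a (x (b' a'')) b''\<close>. On
  pure \<open>x\<close> the claim comes down to \<open>tw_mul_left\<close>; the next lemma is its
  mirror image.\<close>

lemma tmul_act_left:
  assumes h: "a \<in> carrier A" "b' \<in> carrier B" "a'' \<in> carrier A" "b'' \<in> carrier B" "x \<in> carrier R"
  shows "tmul (act a b' x) (P a'' b'') = act a b'' (tmul x (tw b' a''))"
proof (rule tensor_ext[OF _ _ A.vs(1) B.vs(1) _ h(5), where U = R])
  fix p q assume pq: "p \<in> carrier A" "q \<in> carrier B"
  show "tmul (act a b' (P p q)) (P a'' b'') = act a b'' (tmul (P p q) (tw b' a''))"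
    using pq h by (subst tmul_left_pure) (simp_all add: lin act_pure tmul_pure tw_mul_left[symmetric] act_act B.mul_unt_left)
qed (use h in \<open>simp_all add: lin\<close>)

lemma tmul_act_right:
  assumes h: "a \<in> carrier A" "b \<in> carrier B" "a' \<in> carrier A" "b'' \<in> carrier B" "x \<in> carrier R"
  shows "tmul (P a b) (act a' b'' x) = act a b'' (tmul (tw b a') x)"
proof (rule tensor_ext[OF _ _ A.vs(1) B.vs(1) _ h(5), where U = R])
  fix p q assume pq: "p \<in> carrier A" "q \<in> carrier B"
  show "tmul (P a b) (act a' b'' (P p q)) = act a b'' (tmul (tw b a') (P p q))"
    using pq h by (subst tmul_right_pure) (simp_all add: lin act_pure tmul_pure tw_mul_right[symmetric] act_act A.mul_unt_right)
qed (use h in \<open>simp_all add: lin\<close>)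

text \<open>On pure tensors \<open>a b\<close>, \<open>a' b'\<close>, \<open>a'' b''\<close> both
  bracketings equal \<open>a (\<tau>(b \<otimes> a') \<tau>(b' \<otimes> a'')) b''\<close>.\<close>

lemma tmul_assoc:
  assumes x: "x \<in> carrier R" and y: "y \<in> carrier R" and z: "z \<in> carrier R"
  shows "tmul (tmul x y) z = tmul x (tmul y z)"
proof (rule tensor_ext[OF _ _ A.vs(1) B.vs(1) _ x, where U = R])
  fix a b assume ab: "a \<in> carrier A" "b \<in> carrier B"
  show "tmul (tmul (P a b) y) z = tmul (P a b) (tmul y z)"
  proof (rule tensor_ext[OF _ _ A.vs(1) B.vs(1) _ y, where U = R])
    fix a' b' assume ab': "a' \<in> carrier A" "b' \<in> carrier B"
    show "tmul (tmul (P a b) (P a' b')) z = tmul (P a b) (tmul (P a' b') z)"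
      by (rule tensor_ext[OF _ _ A.vs(1) B.vs(1) _ z, where U = R])
        (use ab ab' in \<open>simp_all add: lin tmul_pure tmul_act_left tmul_act_right\<close>)
  qed (use ab z in \<open>simp_all add: lin\<close>)
qed (use y z in \<open>simp_all add: lin\<close>)

lemma tmul_embed:
  assumes "x \<in> carrier R" 
  shows tmul_embed_left: "a \<in> carrier A \<Longrightarrow> tmul (P a B.unt) x = act a B.unt x"
    and tmul_embed_right: "b \<in> carrier B \<Longrightarrow> tmul x (P A.unt b) = act A.unt b x"
proof -
  show "tmul (P a B.unt) x = act a B.unt x" if "a \<in> carrier A"
    by (rule tensor_ext[OF _ _ A.vs(1) B.vs(1) _ assms, where U = R])
      (use that in \<open>simp_all add: lin tmul_pure tau_unit_B act_pure B.mul_unt_left B.mul_unt_right\<close>)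
  show "tmul x (P A.unt b) = act A.unt b x" if "b \<in> carrier B"
    by (rule tensor_ext[OF _ _ A.vs(1) B.vs(1) _ assms, where U = R])
      (use that in \<open>simp_all add: lin tmul_pure tau_unit_A act_pure A.mul_unt_left A.mul_unt_right\<close>)
qed

lemma twisted_unit_linear: "linear_map K (ground K) R (twisted_unit K A etaA B etaB)"
  unfolding twisted_unit_def comp_def ground_split_def
  by (simp add: lin A.eta_linear B.eta_linear)

lemma twisted_unit_one: "twisted_unit K A etaA B etaB \<one>\<^bsub>K\<^esub> = P A.unt B.unt"
  unfolding twisted_unit_def comp_def ground_split_def
  by (simp add: lin A.eta_linear B.eta_linear tensor_map_pure)

lemma twisted_k_algebra:
  "k_algebra K R (twisted_mult K A nablaA B nablaB tau) (twisted_unit K A etaA B etaB)"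
  by (rule k_algebraI)
    (simp_all add: lin twisted_mult_linear twisted_unit_linear twisted_unit_one tmul_assoc
      tmul_embed_left tmul_embed_right act_unt)

end

section \<open>Frobenius algebras from Casimir elements\<close>

text \<open>Lets an identity that holds only on carriers be used below a lift: on pure tensors the
  two lifts are values of \<open>\<beta>\<close> and \<open>\<beta>'\<close>.\<close>

lemma tensor_lift_cong:
  assumes b: "bilinear_map K V W U \<beta>"
    and eq: "\<And>v w. v \<in> carrier V \<Longrightarrow> w \<in> carrier W \<Longrightarrow> \<beta> v w = \<beta>' v w"
    and t: "t \<in> carrier (tensor K V W)"
  shows "tensor_lift K V W U \<beta> t = tensor_lift K V W U \<beta>' t"
proof -
  have b': "bilinear_map K V W U \<beta>'"
    using b linear_map_cong eq unfolding bilinear_map_def by (smt (verit))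
  show ?thesis
    by (rule tensor_ext[OF tensor_lift_linear[OF b] tensor_lift_linear[OF b'] _ _ _ t])
      (use b in \<open>auto simp: bilinear_map_def tensor_lift_pure[OF b] tensor_lift_pure[OF b'] eq\<close>)
qed

lemma smult_pure_tensor:
  assumes "vectorspace K V" "vectorspace K W" "c \<in> carrier (ground K)" "v \<in> carrier V" "w \<in> carrier W"
  shows "pure_tensor K V W (c \<odot>\<^bsub>V\<^esub> v) w = c \<odot>\<^bsub>tensor K V W\<^esub> pure_tensor K V W v w"
    and "pure_tensor K V W v (c \<odot>\<^bsub>W\<^esub> w) = c \<odot>\<^bsub>tensor K V W\<^esub> pure_tensor K V W v w"
  using linear_map_smult[of K V "tensor K V W" "\<lambda>v. pure_tensor K V W v w" c v]
    linear_map_smult[of K W "tensor K V W" "\<lambda>w. pure_tensor K V W v w" c w] assms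
  by (simp_all add: lin carrier_ground)

lemma smult_smult:
  assumes V: "vectorspace K V"
    and "c \<in> carrier (ground K)" "d \<in> carrier (ground K)" "v \<in> carrier V"
  shows "c \<odot>\<^bsub>V\<^esub> (d \<odot>\<^bsub>V\<^esub> v) = (c \<otimes>\<^bsub>K\<^esub> d) \<odot>\<^bsub>V\<^esub> v"
proof -
  interpret V: vectorspace K V by fact
  show ?thesis using assms by (simp add: carrier_ground V.smult_assoc1)
qed

section \<open>Counit and Frobenius identities in Sweedler form\<close>

context k_coalgebra
begin

lemma coalgebra_vs [lin]: "vectorspace K C" "vectorspace K (ground K)"
  using vectorspace_axioms by (auto intro: ground_vectorspace)

lemmas coalgebra_lin [lin] = linear_map_comp[OF Delta_linear] linear_map_closed[OF Delta_linear]
  linear_map_comp[OF epsilon_linear] linear_map_closed[OF epsilon_linear]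

text \<open>On pure tensors the lift absorbs the unit isomorphism, which turns the counit axiom into
  its Sweedler form.\<close>

lemma counit_left_lift:
  assumes "c \<in> carrier C"
  shows "tensor_lift K C C C (\<lambda>p q. epsilon p \<odot>\<^bsub>C\<^esub> q) (Delta c) = c"
proof -
  have "lunit K C (tensor_map K C C (ground K) C epsilon id t) = tensor_lift K C C C (\<lambda>p q. epsilon p \<odot>\<^bsub>C\<^esub> q) t"
    if "t \<in> carrier (tensor K C C)" for t
    by (rule tensor_ext[OF _ _ coalgebra_vs(1) coalgebra_vs(1) _ that, where U = C])
      (simp_all add: lin linear_map_id' epsilon_linear tensor_map_pure lunit_pure tensor_lift_pure)
  then show ?thesis using counit_left[OF assms] assms by (simp add: lin)
qed

lemma counit_right_lift:
  assumes "c \<in> carrier C"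
  shows "tensor_lift K C C C (\<lambda>p q. epsilon q \<odot>\<^bsub>C\<^esub> p) (Delta c) = c"
proof -
  have "runit K C (tensor_map K C C C (ground K) id epsilon t) = tensor_lift K C C C (\<lambda>p q. epsilon q \<odot>\<^bsub>C\<^esub> p) t"
    if "t \<in> carrier (tensor K C C)" for t
    by (rule tensor_ext[OF _ _ coalgebra_vs(1) coalgebra_vs(1) _ that, where U = C])
      (simp_all add: lin linear_map_id' epsilon_linear tensor_map_pure runit_pure tensor_lift_pure)
  then show ?thesis using counit_right[OF assms] assms by (simp add: lin)
qed

end

context k_algebra
begin

lemma nabla_smult:
  "c \<in> carrier (ground K) \<Longrightarrow> t \<in> carrier (tensor K A A) \<Longrightarrow> nabla (c \<odot>\<^bsub>tensor K A A\<^esub> t) = c \<odot>\<^bsub>A\<^esub> nabla t"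
  using linear_map_smult[OF nabla_linear] by (simp add: carrier_ground)

text \<open>For \<open>t = \<Delta>(a)\<close> the left side is the right side of the first
  Frobenius identity at \<open>a \<otimes> b\<close>, so that identity says that \<open>b\<close>
  multiplies the second leg of \<open>\<Delta>(a)\<close>.\<close>

lemma frobenius_left_lift:
  assumes "t \<in> carrier (tensor K A A)" "b \<in> carrier A"
  shows "tensor_map K A (tensor K A A) A A id nabla (tassoc K A A A (pure_tensor K (tensor K A A) A t b))
    = tensor_lift K A A (tensor K A A) (\<lambda>p q. pure_tensor K A A p (mul q b)) t"
  by (rule tensor_ext[OF _ _ vs(1) vs(1) _ assms(1), where U = "tensor K A A"])
    (use assms(2) in \<open>simp_all add: lin nabla_linear tensor_map_pure tensor_lift_pure tassoc_pure\<close>)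

lemma frobenius_right_lift:
  assumes "t \<in> carrier (tensor K A A)" "a \<in> carrier A"
  shows "tensor_map K (tensor K A A) A A A nabla id (tassoc_inv K A A A (pure_tensor K A (tensor K A A) a t))
    = tensor_lift K A A (tensor K A A) (\<lambda>p q. pure_tensor K A A (mul a p) q) t"
  by (rule tensor_ext[OF _ _ vs(1) vs(1) _ assms(1), where U = "tensor K A A"])
    (use assms(2) in \<open>simp_all add: lin nabla_linear tensor_map_pure tensor_lift_pure tassoc_inv_pure\<close>)

text \<open>A copairing \<open>C\<close> that is dual on both sides to the form \<open>\<epsilon>(x y)\<close> satisfies \<open>x C = C x\<close>: both sides
  equal \<open>\<Sum> \<epsilon>(q' x p) p' \<otimes> q\<close>, summed over two copies \<open>p \<otimes> q\<close> and \<open>p' \<otimes> q'\<close> of \<open>C\<close>.\<close>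

lemma casimir_central:
  assumes e: "linear_map K A (ground K) e" and C: "C \<in> carrier (tensor K A A)"
    and snake_left: "\<And>x. x \<in> carrier A \<Longrightarrow> tensor_lift K A A A (\<lambda>p q. e (mul x p) \<odot>\<^bsub>A\<^esub> q) C = x"
    and snake_right: "\<And>x. x \<in> carrier A \<Longrightarrow> tensor_lift K A A A (\<lambda>p q. e (mul q x) \<odot>\<^bsub>A\<^esub> p) C = x"
    and x: "x \<in> carrier A"
  shows "tensor_lift K A A (tensor K A A) (\<lambda>p q. pure_tensor K A A (mul x p) q) C
    = tensor_lift K A A (tensor K A A) (\<lambda>p q. pure_tensor K A A p (mul q x)) C"
proof -
  let ?AA = "tensor K A A" and ?p = "pure_tensor K A A"
  note [lin] = linear_map_comp[OF e] linear_map_closed[OF e]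
  \<comment> \<open>The two copies of \<open>C\<close> are freed as \<open>s\<close> and
    \<open>t\<close>, so that the exchange of summations can be checked on pure tensors in
    each.\<close>
  have fubini: "tensor_lift K A A ?AA (\<lambda>p q. ?p (tensor_lift K A A A (\<lambda>p' q'. e (mul q' (mul x p)) \<odot>\<^bsub>A\<^esub> p') t) q) s
    = tensor_lift K A A ?AA (\<lambda>p' q'. ?p p' (tensor_lift K A A A (\<lambda>p q. e (mul (mul q' x) p) \<odot>\<^bsub>A\<^esub> q) s)) t"
    if s: "s \<in> carrier ?AA" and t: "t \<in> carrier ?AA" for s t
  proof (rule tensor_ext[OF _ _ vs(1) vs(1) _ t, where U = ?AA])
    fix p' q' assume h: "p' \<in> carrier A" "q' \<in> carrier A"
    show "tensor_lift K A A ?AA (\<lambda>p q. ?p (tensor_lift K A A A (\<lambda>p' q'. e (mul q' (mul x p)) \<odot>\<^bsub>A\<^esub> p') (?p p' q')) q) s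
      = tensor_lift K A A ?AA (\<lambda>p' q'. ?p p' (tensor_lift K A A A (\<lambda>p q. e (mul (mul q' x) p) \<odot>\<^bsub>A\<^esub> q) s)) (?p p' q')"
      by (rule tensor_ext[OF _ _ vs(1) vs(1) _ s, where U = ?AA])
        (use h x in \<open>simp_all add: lin tensor_lift_pure smult_pure_tensor mul_assoc\<close>)
  qed (use s x in \<open>simp_all add: lin\<close>)
  have "tensor_lift K A A ?AA (\<lambda>p q. ?p (mul x p) q) C
      = tensor_lift K A A ?AA (\<lambda>p q. ?p (tensor_lift K A A A (\<lambda>p' q'. e (mul q' (mul x p)) \<odot>\<^bsub>A\<^esub> p') C) q) C"
    by (rule tensor_lift_cong[OF _ _ C]) (use x in \<open>simp_all add: lin snake_right\<close>)
  also have "\<dots> = tensor_lift K A A ?AA (\<lambda>p' q'. ?p p' (tensor_lift K A A A (\<lambda>p q. e (mul (mul q' x) p) \<odot>\<^bsub>A\<^esub> q) C)) C"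
    by (rule fubini[OF C C])
  also have "\<dots> = tensor_lift K A A ?AA (\<lambda>p q. ?p p (mul q x)) C"
    by (rule tensor_lift_cong[OF _ _ C]) (use x C in \<open>simp_all add: lin snake_left\<close>)
  finally show ?thesis .
qed

text \<open>If \<open>\<Delta>(x) = x C = C x\<close>, where the products act on the outer side of
  the first and second leg, then associativity gives
  \<open>\<Delta>(a b) = a \<Delta>(b) = \<Delta>(a) b\<close>. These are the Frobenius
  identities.\<close>

lemma frobenius_algebraI:
  assumes co: "k_coalgebra K A Delta epsilon" and C: "C \<in> carrier (tensor K A A)"
    and left: "\<And>x. x \<in> carrier A \<Longrightarrow>
      Delta x = tensor_lift K A A (tensor K A A) (\<lambda>p q. pure_tensor K A A (mul x p) q) C"
    and right: "\<And>x. x \<in> carrier A \<Longrightarrow>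
      Delta x = tensor_lift K A A (tensor K A A) (\<lambda>p q. pure_tensor K A A p (mul q x)) C"
  shows "frobenius_algebra K A nabla eta Delta epsilon"
proof -
  interpret co: k_coalgebra K A Delta epsilon by fact
  let ?AA = "tensor K A A" and ?p = "pure_tensor K A A"
  have Delta_right: "Delta (mul a b) = tensor_lift K A A ?AA (\<lambda>p q. ?p p (mul q b)) (Delta a)"
    if h: "a \<in> carrier A" "b \<in> carrier A" for a b
  proof -
    have "tensor_lift K A A ?AA (\<lambda>p q. ?p p (mul q (mul a b))) C
      = tensor_lift K A A ?AA (\<lambda>p q. ?p p (mul q b)) (tensor_lift K A A ?AA (\<lambda>p q. ?p p (mul q a)) C)"
      by (rule tensor_ext[OF _ _ vs(1) vs(1) _ C, where U = ?AA])
        (use h in \<open>simp_all add: lin tensor_lift_pure mul_assoc\<close>)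
    then show ?thesis using h by (simp add: right lin)
  qed
  have Delta_left: "Delta (mul a b) = tensor_lift K A A ?AA (\<lambda>p q. ?p (mul a p) q) (Delta b)"
    if h: "a \<in> carrier A" "b \<in> carrier A" for a b
  proof -
    have "tensor_lift K A A ?AA (\<lambda>p q. ?p (mul (mul a b) p) q) C
      = tensor_lift K A A ?AA (\<lambda>p q. ?p (mul a p) q) (tensor_lift K A A ?AA (\<lambda>p q. ?p (mul b p) q) C)"
      by (rule tensor_ext[OF _ _ vs(1) vs(1) _ C, where U = ?AA])
        (use h in \<open>simp_all add: lin tensor_lift_pure mul_assoc\<close>)
    then show ?thesis using h by (simp add: left lin)
  qed
  show ?thesis
  proof (intro frobenius_algebra.intro frobenius_algebra_axioms.intro k_algebra_axioms co)
    fix x assume x: "x \<in> carrier ?AA"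
    show "(Delta \<circ> nabla) x = (tensor_map K A ?AA A A id nabla \<circ> tassoc K A A A
         \<circ> tensor_map K A A ?AA A Delta id) x"
      by (rule tensor_ext[OF _ _ vs(1) vs(1) _ x, where U = ?AA])
        (simp_all add: comp_def lin nabla_linear co.Delta_linear tensor_map_pure Delta_right frobenius_left_lift[unfolded id_def] id_def)
    show "(Delta \<circ> nabla) x = (tensor_map K ?AA A A A nabla id \<circ> tassoc_inv K A A A
         \<circ> tensor_map K A A A ?AA id Delta) x"
      by (rule tensor_ext[OF _ _ vs(1) vs(1) _ x, where U = ?AA])
        (simp_all add: comp_def lin nabla_linear co.Delta_linear tensor_map_pure Delta_left frobenius_right_lift[unfolded id_def] id_def)
  qed
qed

end

section \<open>The Casimir element of a Frobenius algebra\<close>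

context frobenius_algebra
begin

abbreviation casimir where "casimir \<equiv> Delta unt"

text \<open>The first Frobenius identity at \<open>1 \<otimes> a\<close>; the mirror image uses the
  second one at \<open>a \<otimes> 1\<close>.\<close>

lemma Delta_casimir_left:
  assumes a: "a \<in> carrier A"
  shows "Delta a = tensor_lift K A A (tensor K A A) (\<lambda>p q. pure_tensor K A A p (mul q a)) casimir"
proof -
  have "Delta (mul unt a) = tensor_lift K A A (tensor K A A) (\<lambda>p q. pure_tensor K A A p (mul q a)) casimir"
    using frobenius_left[of "pure_tensor K A A unt a"] a
    by (simp add: lin tensor_map_pure Delta_linear frobenius_left_lift)
  then show ?thesis using a by (simp add: mul_unt_left)
qed

lemma Delta_casimir_right:
  assumes a: "a \<in> carrier A"
  shows "Delta a = tensor_lift K A A (tensor K A A) (\<lambda>p q. pure_tensor K A A (mul a p) q) casimir"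
proof -
  have "Delta (mul a unt) = tensor_lift K A A (tensor K A A) (\<lambda>p q. pure_tensor K A A (mul a p) q) casimir"
    using frobenius_right[of "pure_tensor K A A a unt"] a
    by (simp add: lin tensor_map_pure Delta_linear frobenius_right_lift)
  then show ?thesis using a by (simp add: mul_unt_right)
qed

lemma casimir_closed [lin]: "casimir \<in> carrier (tensor K A A)"
  by (simp add: lin)

text \<open>Applying the counit to the first leg of \<open>\<Delta>(a) = a C\<close> returns
  \<open>a\<close>. Together with the mirror image this says that \<open>C = \<Delta>(1)\<close> is
  dual to the form \<open>\<epsilon>(x y)\<close> on both sides.\<close>

lemma casimir_snake_left:
  assumes a: "a \<in> carrier A"
  shows "tensor_lift K A A A (\<lambda>p q. epsilon (mul a p) \<odot>\<^bsub>A\<^esub> q) casimir = a"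
proof -
  have "tensor_lift K A A A (\<lambda>p q. epsilon (mul a p) \<odot>\<^bsub>A\<^esub> q) casimir
      = tensor_lift K A A A (\<lambda>p q. epsilon p \<odot>\<^bsub>A\<^esub> q) (tensor_lift K A A (tensor K A A) (\<lambda>p q. pure_tensor K A A (mul a p) q) casimir)"
    by (rule tensor_ext[OF _ _ vs(1) vs(1) _ casimir_closed, where U = A])
      (use a in \<open>simp_all add: lin tensor_lift_pure\<close>)
  then show ?thesis using counit_left_lift[OF a] Delta_casimir_right[OF a] by simp
qed

lemma casimir_snake_right:
  assumes a: "a \<in> carrier A"
  shows "tensor_lift K A A A (\<lambda>p q. epsilon (mul q a) \<odot>\<^bsub>A\<^esub> p) casimir = a"
proof -
  have "tensor_lift K A A A (\<lambda>p q. epsilon (mul q a) \<odot>\<^bsub>A\<^esub> p) casimir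
      = tensor_lift K A A A (\<lambda>p q. epsilon q \<odot>\<^bsub>A\<^esub> p) (tensor_lift K A A (tensor K A A) (\<lambda>p q. pure_tensor K A A p (mul q a)) casimir)"
    by (rule tensor_ext[OF _ _ vs(1) vs(1) _ casimir_closed, where U = A])
      (use a in \<open>simp_all add: lin tensor_lift_pure\<close>)
  then show ?thesis using counit_right_lift[OF a] Delta_casimir_left[OF a] by simp
qed

end

section \<open>Twisted tensor products of Frobenius algebras\<close>

text \<open>Collects the hypotheses of the nontrivial implication.\<close>

locale twisted_frobenius =
  A: frobenius_algebra K A nablaA etaA DeltaA epsilonA + B: frobenius_algebra K B nablaB etaB DeltaB epsilonB
  + twisting_map K A nablaA etaA B nablaB etaB tau
  + AB: k_coalgebra K "tensor K A B" "twisted_comult K A DeltaA B DeltaB tau" "twisted_counit K A epsilonA B epsilonB"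
  for K A nablaA etaA DeltaA epsilonA B nablaB etaB DeltaB epsilonB tau
begin

sublocale AB: k_algebra K "tensor K A B" "twisted_mult K A nablaA B nablaB tau" "twisted_unit K A etaA B etaB"
  by (rule twisted_k_algebra)

abbreviation iA where "iA a \<equiv> P a B.unt"
abbreviation iB where "iB b \<equiv> P A.unt b"
abbreviation eps where "eps \<equiv> twisted_counit K A epsilonA B epsilonB"
abbreviation tau' where "tau' \<equiv> inv_into (carrier (tensor K B A)) tau"
abbreviation mid' where "mid' \<equiv> mid_map K A A B B A B tau'"
abbreviation pm where "pm \<equiv> pure_tensor K (tensor K A A) (tensor K B B)"
abbreviation RR where "RR \<equiv> tensor K R R"
abbreviation pR where "pR \<equiv> pure_tensor K R R"

section \<open>Partial counits and the inverse of the twist\<close>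

text \<open>\<open>EA\<close> is \<open>\<epsilon>_A \<otimes> 1\<close> and \<open>EB\<close> is
  \<open>1 \<otimes> \<epsilon>_B\<close>. Written as lifts, they include the identifications of
  \<open>k \<otimes> B\<close> with \<open>B\<close> and of \<open>A \<otimes> k\<close> with
  \<open>A\<close>.\<close>

definition EA where "EA x = tensor_lift K A B B (\<lambda>p q. epsilonA p \<odot>\<^bsub>B\<^esub> q) x"
definition EB where "EB x = tensor_lift K A B A (\<lambda>p q. epsilonB q \<odot>\<^bsub>A\<^esub> p) x"

lemma EA_lin [lin]:
  shows "linear_map K X R f \<Longrightarrow> linear_map K X B (\<lambda>t. EA (f t))"
    and "x \<in> carrier R \<Longrightarrow> EA x \<in> carrier B"
    and EA_pure: "a \<in> carrier A \<Longrightarrow> b \<in> carrier B \<Longrightarrow> EA (P a b) = epsilonA a \<odot>\<^bsub>B\<^esub> b"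
  unfolding EA_def by (simp_all add: lin tensor_lift_pure)

lemma EB_lin [lin]:
  shows "linear_map K X R f \<Longrightarrow> linear_map K X A (\<lambda>t. EB (f t))"
    and "x \<in> carrier R \<Longrightarrow> EB x \<in> carrier A"
    and EB_pure: "a \<in> carrier A \<Longrightarrow> b \<in> carrier B \<Longrightarrow> EB (P a b) = epsilonB b \<odot>\<^bsub>A\<^esub> a"
  unfolding EB_def by (simp_all add: lin tensor_lift_pure)

lemma tau_inv:
  shows tau_tau': "x \<in> carrier R \<Longrightarrow> tau (tau' x) = x"
    and tau'_tau: "t \<in> carrier (tensor K B A) \<Longrightarrow> tau' (tau t) = t"
    and tau'_linear: "linear_map K R (tensor K B A) tau'"
proof -
  let ?BA = "tensor K B A"
  have t: "tau (tau' x) = x" if "x \<in> carrier R" for x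
    using bij_betw_inv_into_right[OF tau_bij that] .
  show "tau' (tau t) = t" if "t \<in> carrier ?BA" for t
    using bij_betw_inv_into_left[OF tau_bij that] .
  have c: "tau' x \<in> carrier ?BA" if "x \<in> carrier R" for x
    using bij_betw_apply[OF bij_betw_inv_into[OF tau_bij] that] .
  \<comment> \<open>Linearity of the inverse is tested after applying \<open>tau\<close>, which is
    linear and injective.\<close>
  have inj: "s = t" if "tau s = tau t" "s \<in> carrier ?BA" "t \<in> carrier ?BA" for s t
    using that bij_betw_imp_inj_on[OF tau_bij] by (auto dest: inj_onD)
  have BA: "vectorspace K ?BA" and R: "vectorspace K R" by (simp_all add: lin)
  interpret BA: vectorspace K ?BA by fact
  interpret R: vectorspace K R by fact
  show "linear_map K R ?BA tau'"
  proof (rule linear_mapI[OF R BA c])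
    show "tau' (x \<oplus>\<^bsub>R\<^esub> y) = tau' x \<oplus>\<^bsub>?BA\<^esub> tau' y" if "x \<in> carrier R" "y \<in> carrier R" for x y
      by (rule inj) (use that in \<open>simp_all add: t c linear_map_add[OF tau_linear]\<close>)
    show "tau' (k \<odot>\<^bsub>R\<^esub> x) = k \<odot>\<^bsub>?BA\<^esub> tau' x" if "k \<in> carrier K" "x \<in> carrier R" for k x
      by (rule inj) (use that in \<open>simp_all add: t c linear_map_smult[OF tau_linear]\<close>)
  qed
  show "x \<in> carrier R \<Longrightarrow> tau (tau' x) = x" by (rule t)
qed

lemmas tau'_lin [lin] = linear_map_comp[OF tau'_linear] linear_map_closed[OF tau'_linear]

text \<open>Since \<open>\<tau>\<close> is onto, linear maps on the twisted product are determined by the products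
  \<open>(1 \<otimes> b) (a \<otimes> 1) = \<tau>(b \<otimes> a)\<close> as well.\<close>

lemma twisted_ext:
  assumes f: "linear_map K R U f" and g: "linear_map K R U g"
    and eq: "\<And>b a. b \<in> carrier B \<Longrightarrow> a \<in> carrier A \<Longrightarrow> f (tw b a) = g (tw b a)"
    and x: "x \<in> carrier R"
  shows "f x = g x"
proof -
  have "f (tau t) = g (tau t)" if "t \<in> carrier (tensor K B A)" for t
    by (rule tensor_ext[OF linear_map_comp[OF f tau_linear] linear_map_comp[OF g tau_linear] _ _ eq that])
      (simp_all add: lin)
  from this[of "tau' x"] x show ?thesis by (simp add: tau_tau' lin)
qed

lemma eps_linear: "linear_map K R (ground K) eps"
  unfolding twisted_counit_def comp_def by (simp add: lin A.epsilon_linear B.epsilon_linear)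

lemma eps_pure: "a \<in> carrier A \<Longrightarrow> b \<in> carrier B \<Longrightarrow> eps (P a b) = epsilonA a \<otimes>\<^bsub>K\<^esub> epsilonB b"
  unfolding twisted_counit_def comp_def
  by (simp add: lin A.epsilon_linear B.epsilon_linear tensor_map_pure lunit_pure)

lemmas mid'_linear = mid_map_linear[OF A.vs(1) B.vs(1) tau'_linear B.vs(1) A.vs(1) B.vs(1) A.vs(1)]

lemmas mid'_lin [lin] = linear_map_comp[OF mid'_linear] linear_map_closed[OF mid'_linear]

lemma mid'_pure:
  assumes "e \<in> carrier A" "f \<in> carrier A" "u \<in> carrier B" "v \<in> carrier B"
  shows "mid' (pm (pure_tensor K A A e f) (pure_tensor K B B u v))
    = tensor_lift K B A RR (\<lambda>b' a'. pR (P e b') (P a' v)) (tau' (P f u))"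
  using assms by (intro mid_map_pure) (simp_all add: lin tau'_linear)

lemma scalar:
  assumes c: "c \<in> carrier (ground K)"
  shows tau_smult: "t \<in> carrier (tensor K B A) \<Longrightarrow> tau (c \<odot>\<^bsub>tensor K B A\<^esub> t) = c \<odot>\<^bsub>R\<^esub> tau t"
    and EA_smult: "x \<in> carrier R \<Longrightarrow> EA (c \<odot>\<^bsub>R\<^esub> x) = c \<odot>\<^bsub>B\<^esub> EA x"
    and EB_smult: "x \<in> carrier R \<Longrightarrow> EB (c \<odot>\<^bsub>R\<^esub> x) = c \<odot>\<^bsub>A\<^esub> EB x"
    and epsilonA_smult: "a \<in> carrier A \<Longrightarrow> epsilonA (c \<odot>\<^bsub>A\<^esub> a) = c \<otimes>\<^bsub>K\<^esub> epsilonA a"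
    and epsilonB_smult: "b \<in> carrier B \<Longrightarrow> epsilonB (c \<odot>\<^bsub>B\<^esub> b) = c \<otimes>\<^bsub>K\<^esub> epsilonB b"
  using c linear_map_smult[OF tau_linear, of c t] linear_map_smult[of K R B "\<lambda>x. EA x" c x]
    linear_map_smult[of K R A "\<lambda>x. EB x" c x] linear_map_smult[OF A.epsilon_linear, of c a]
    linear_map_smult[OF B.epsilon_linear, of c b]
  by (simp_all add: lin carrier_ground)

lemma ground_ac:
  assumes "c \<in> carrier (ground K)" "d \<in> carrier (ground K)"
  shows "c \<otimes>\<^bsub>K\<^esub> d \<in> carrier (ground K)" and "c \<otimes>\<^bsub>K\<^esub> d = d \<otimes>\<^bsub>K\<^esub> c"
    and "r \<in> carrier (ground K) \<Longrightarrow> c \<otimes>\<^bsub>K\<^esub> d \<otimes>\<^bsub>K\<^esub> r = c \<otimes>\<^bsub>K\<^esub> (d \<otimes>\<^bsub>K\<^esub> r)"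
    and "r \<in> carrier (ground K) \<Longrightarrow> c \<otimes>\<^bsub>K\<^esub> (d \<otimes>\<^bsub>K\<^esub> r) = d \<otimes>\<^bsub>K\<^esub> (c \<otimes>\<^bsub>K\<^esub> r)"
  using assms unfolding carrier_ground by (simp_all add: A.m_assoc A.m_comm A.m_lcomm)

lemmas scalars = scalar smult_pure_tensor A.nabla_smult B.nabla_smult AB.nabla_smult
  smult_smult[OF A.vs(1)] smult_smult[OF B.vs(1)] smult_smult[OF AB.vs(1)] ground_ac

lemma twisted_comult_pure:
  assumes "a \<in> carrier A" "b \<in> carrier B"
  shows "twisted_comult K A DeltaA B DeltaB tau (P a b) = mid' (pm (DeltaA a) (DeltaB b))"
  unfolding twisted_comult_def comp_def
  using assms by (simp add: lin tensor_map_pure A.Delta_linear B.Delta_linear)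

section \<open>Compatibility of the counits with the twist\<close>

text \<open>\<open>EB\<close> is applied to the left counit law of the product at
  \<open>a \<otimes> b'\<close>. Write \<open>\<Delta>_A(a) = \<Sum> e \<otimes> f\<close> and
  \<open>\<Delta>_B(b') = \<Sum> u \<otimes> v\<close>. The counits contract the outer legs
  \<open>e\<close> and \<open>v\<close>, leaving \<open>EB(a \<otimes> b') = (\<epsilon>_B \<otimes>
  1)(\<tau>^{-1}(a \<otimes> b'))\<close>, and evaluation at a value of \<open>\<tau>\<close> gives
  the claim.\<close>

lemma EB_tw:
  assumes a: "a \<in> carrier A" and b: "b \<in> carrier B"
  shows "EB (tw b a) = epsilonB b \<odot>\<^bsub>A\<^esub> a"
proof -
  let ?F = "\<lambda>t. tensor_lift K B A A (\<lambda>b a. epsilonB b \<odot>\<^bsub>A\<^esub> a) t"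
  have 1: "EB (lunit K R (tensor_map K R R (ground K) R eps id
        (tensor_lift K B A RR (\<lambda>b' a'. pR (P e b') (P a' v)) t)))
      = (epsilonA e \<otimes>\<^bsub>K\<^esub> epsilonB v) \<odot>\<^bsub>A\<^esub> ?F t"
    if h: "e \<in> carrier A" "v \<in> carrier B" and t: "t \<in> carrier (tensor K B A)" for e v t
    by (rule tensor_ext[OF _ _ B.vs(1) A.vs(1) _ t, where U = A])
      (use h in \<open>simp_all add: lin tensor_lift_pure tensor_map_pure eps_linear eps_pure EB_pure lunit_pure
        scalars\<close>)
  \<comment> \<open>These contractions are the identity on comultiplied elements: \<open>?l\<close>
    undoes \<open>\<Delta>_A\<close> by the left counit law, \<open>?r\<close> undoes
    \<open>\<Delta>_B\<close> by the right one.\<close>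
  let ?l = "\<lambda>s. tensor_lift K A A A (\<lambda>p q. epsilonA p \<odot>\<^bsub>A\<^esub> q) s"
  let ?r = "\<lambda>t. tensor_lift K B B B (\<lambda>p q. epsilonB q \<odot>\<^bsub>B\<^esub> p) t"
  let ?G = "\<lambda>y. EB (lunit K R (tensor_map K R R (ground K) R eps id (mid' y)))"
  have 2: "?G (pm s t) = ?F (tau' (P (?l s) (?r t)))"
    if s: "s \<in> carrier (tensor K A A)" and t: "t \<in> carrier (tensor K B B)" for s t
  proof (rule tensor_ext[OF _ _ A.vs(1) A.vs(1) _ s, where U = A])
    fix e f assume h: "e \<in> carrier A" "f \<in> carrier A"
    show "?G (pm (pure_tensor K A A e f) t) = ?F (tau' (P (?l (pure_tensor K A A e f)) (?r t)))"
    proof (rule tensor_ext[OF _ _ B.vs(1) B.vs(1) _ t, where U = A])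
      fix u v assume h': "u \<in> carrier B" "v \<in> carrier B"
      have "?F (tau' ((epsilonA e \<otimes>\<^bsub>K\<^esub> epsilonB v) \<odot>\<^bsub>R\<^esub> P f u))
          = (epsilonA e \<otimes>\<^bsub>K\<^esub> epsilonB v) \<odot>\<^bsub>A\<^esub> ?F (tau' (P f u))"
        by (rule linear_map_smult[of K R A "\<lambda>x. ?F (tau' x)"]) (use h h' in \<open>simp_all add: lin ground_ac flip: carrier_ground[of K]\<close>)
      then show "?G (pm (pure_tensor K A A e f) (pure_tensor K B B u v))
          = ?F (tau' (P (?l (pure_tensor K A A e f)) (?r (pure_tensor K B B u v))))"
        using h h' by (simp add: mid'_pure 1 lin tensor_lift_pure scalars)
    qed (use h in \<open>simp_all add: lin eps_linear\<close>)
  qed (use t in \<open>simp_all add: lin eps_linear\<close>)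
  have 3: "EB (P a b') = ?F (tau' (P a b'))" if "a \<in> carrier A" "b' \<in> carrier B" for a b'
    using 2[of "DeltaA a" "DeltaB b'"] AB.counit_left[of "P a b'"] that
    by (simp add: lin twisted_comult_pure A.counit_left_lift B.counit_right_lift)
  have "EB x = ?F (tau' x)" if "x \<in> carrier R" for x
    by (rule tensor_ext[OF _ _ A.vs(1) B.vs(1) _ that, where U = A]) (simp_all add: lin flip: 3)
  from this[of "tw b a"] show ?thesis using a b by (simp add: lin tau'_tau tensor_lift_pure)
qed

text \<open>The argument for \<open>EB_tw\<close> with the right counit law of the product. The
  outer legs \<open>e\<close> and \<open>v\<close> are again the ones contracted, now by
  \<open>EA\<close> on the first factor and by the counit on the second.\<close>

lemma EA_tw:
  assumes a: "a \<in> carrier A" and b: "b \<in> carrier B"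
  shows "EA (tw b a) = epsilonA a \<odot>\<^bsub>B\<^esub> b"
proof -
  let ?F = "\<lambda>t. tensor_lift K B A B (\<lambda>b a. epsilonA a \<odot>\<^bsub>B\<^esub> b) t"
  have 1: "EA (runit K R (tensor_map K R R R (ground K) id eps
        (tensor_lift K B A RR (\<lambda>b' a'. pR (P e b') (P a' v)) t)))
      = (epsilonA e \<otimes>\<^bsub>K\<^esub> epsilonB v) \<odot>\<^bsub>B\<^esub> ?F t"
    if h: "e \<in> carrier A" "v \<in> carrier B" and t: "t \<in> carrier (tensor K B A)" for e v t
    by (rule tensor_ext[OF _ _ B.vs(1) A.vs(1) _ t, where U = B])
      (use h in \<open>simp_all add: lin tensor_lift_pure tensor_map_pure eps_linear eps_pure EA_pure runit_pure
        scalars\<close>)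
  let ?l = "\<lambda>s. tensor_lift K A A A (\<lambda>p q. epsilonA p \<odot>\<^bsub>A\<^esub> q) s"
  let ?r = "\<lambda>t. tensor_lift K B B B (\<lambda>p q. epsilonB q \<odot>\<^bsub>B\<^esub> p) t"
  let ?G = "\<lambda>y. EA (runit K R (tensor_map K R R R (ground K) id eps (mid' y)))"
  have 2: "?G (pm s t) = ?F (tau' (P (?l s) (?r t)))"
    if s: "s \<in> carrier (tensor K A A)" and t: "t \<in> carrier (tensor K B B)" for s t
  proof (rule tensor_ext[OF _ _ A.vs(1) A.vs(1) _ s, where U = B])
    fix e f assume h: "e \<in> carrier A" "f \<in> carrier A"
    show "?G (pm (pure_tensor K A A e f) t) = ?F (tau' (P (?l (pure_tensor K A A e f)) (?r t)))"
    proof (rule tensor_ext[OF _ _ B.vs(1) B.vs(1) _ t, where U = B])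
      fix u v assume h': "u \<in> carrier B" "v \<in> carrier B"
      have "?F (tau' ((epsilonA e \<otimes>\<^bsub>K\<^esub> epsilonB v) \<odot>\<^bsub>R\<^esub> P f u))
          = (epsilonA e \<otimes>\<^bsub>K\<^esub> epsilonB v) \<odot>\<^bsub>B\<^esub> ?F (tau' (P f u))"
        by (rule linear_map_smult[of K R B "\<lambda>x. ?F (tau' x)"]) (use h h' in \<open>simp_all add: lin ground_ac flip: carrier_ground[of K]\<close>)
      then show "?G (pm (pure_tensor K A A e f) (pure_tensor K B B u v))
          = ?F (tau' (P (?l (pure_tensor K A A e f)) (?r (pure_tensor K B B u v))))"
        using h h' by (simp add: mid'_pure 1 lin tensor_lift_pure scalars)
    qed (use h in \<open>simp_all add: lin eps_linear\<close>)
  qed (use t in \<open>simp_all add: lin eps_linear\<close>)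
  have 3: "EA (P a b') = ?F (tau' (P a b'))" if "a \<in> carrier A" "b' \<in> carrier B" for a b'
    using 2[of "DeltaA a" "DeltaB b'"] AB.counit_right[of "P a b'"] that
    by (simp add: lin twisted_comult_pure A.counit_left_lift B.counit_right_lift)
  have "EA x = ?F (tau' x)" if "x \<in> carrier R" for x
    by (rule tensor_ext[OF _ _ A.vs(1) B.vs(1) _ that, where U = B]) (simp_all add: lin flip: 3)
  from this[of "tw b a"] show ?thesis using a b by (simp add: lin tau'_tau tensor_lift_pure)
qed

section \<open>Reconstruction of an element from its partial counits\<close>

text \<open>Both normal forms, \<open>p q\<close> and \<open>q p\<close> with \<open>p\<close> in
  \<open>A\<close> and \<open>q\<close> in \<open>B\<close>, can be extended at an outer end by an
  element of the factor standing there; no twist has to be evaluated.\<close>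

lemma iA_mul_pure: "a \<in> carrier A \<Longrightarrow> p \<in> carrier A \<Longrightarrow> q \<in> carrier B \<Longrightarrow> tmul (iA a) (P p q) = P (A.mul a p) q"
  and iB_mul_pure: "b \<in> carrier B \<Longrightarrow> p \<in> carrier A \<Longrightarrow> q \<in> carrier B \<Longrightarrow> tmul (P p q) (iB b) = P p (B.mul q b)"
  and iB_mul_tw: "b \<in> carrier B \<Longrightarrow> p \<in> carrier A \<Longrightarrow> q \<in> carrier B \<Longrightarrow> tmul (iB b) (tw q p) = tw (B.mul b q) p"
  and tw_mul_iA: "a \<in> carrier A \<Longrightarrow> p \<in> carrier A \<Longrightarrow> q \<in> carrier B \<Longrightarrow> tmul (tw q p) (iA a) = tw q (A.mul p a)"
  by (simp_all add: lin tmul_embed_left tmul_embed_right act_pure A.mul_unt_left A.mul_unt_right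
      B.mul_unt_left B.mul_unt_right tw_mul_left tw_mul_right)

lemma iA_mul_iB: "a \<in> carrier A \<Longrightarrow> b \<in> carrier B \<Longrightarrow> tmul (iA a) (iB b) = P a b"
  and iB_mul_iA: "a \<in> carrier A \<Longrightarrow> b \<in> carrier B \<Longrightarrow> tmul (iB b) (iA a) = tw b a"
  by (simp add: lin iA_mul_pure A.mul_unt_right, simp add: lin tmul_pure act_unt)

lemma EA_iB_right:
  assumes b: "b \<in> carrier B" and x: "x \<in> carrier R"
  shows "EA (tmul x (iB b)) = B.mul (EA x) b"
  by (rule tensor_ext[OF _ _ A.vs(1) B.vs(1) _ x, where U = B])
    (use b in \<open>simp_all add: lin iB_mul_pure EA_pure scalars\<close>)

lemma EB_iA_left:
  assumes a: "a \<in> carrier A" and x: "x \<in> carrier R"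
  shows "EB (tmul (iA a) x) = A.mul a (EB x)"
  by (rule tensor_ext[OF _ _ A.vs(1) B.vs(1) _ x, where U = A])
    (use a in \<open>simp_all add: lin iA_mul_pure EB_pure scalars\<close>)

lemmas eps_lin [lin] = linear_map_comp[OF eps_linear] linear_map_closed[OF eps_linear]

text \<open>Allows the form \<open>\<epsilon>(x y)\<close> on the product to be evaluated in two
  stages, by a partial counit and then by the counit of the remaining factor.\<close>

lemma eps_factor:
  assumes x: "x \<in> carrier R"
  shows eps_EA: "eps x = epsilonB (EA x)" and eps_EB: "eps x = epsilonA (EB x)"
  by (rule tensor_ext[OF _ _ A.vs(1) B.vs(1) _ x, where U = "ground K"];
      simp add: lin eps_pure EA_pure EB_pure scalars)+

text \<open>For \<open>x = b a\<close> one has \<open>EA(b a e) = \<epsilon>_A(a e) b\<close>, and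
  the sum becomes \<open>b \<Sum> \<epsilon>_A(a e) f = b a\<close>. The form \<open>b a\<close> is
  chosen because \<open>e\<close> arrives next to \<open>a\<close>.\<close>

lemma EA_casimir_left:
  assumes x: "x \<in> carrier R"
  shows "tensor_lift K A A R (\<lambda>e f. tmul (iB (EA (tmul x (iA e)))) (iA f)) A.casimir = x"
proof (rule twisted_ext[OF _ _ _ x, where U = R])
  fix b a assume h: "b \<in> carrier B" "a \<in> carrier A"
  have "tensor_lift K A A R (\<lambda>e f. tmul (iB (EA (tmul (tw b a) (iA e)))) (iA f)) s
      = tw b (tensor_lift K A A A (\<lambda>e f. epsilonA (A.mul a e) \<odot>\<^bsub>A\<^esub> f) s)" if s: "s \<in> carrier (tensor K A A)" for s
    by (rule tensor_ext[OF _ _ A.vs(1) A.vs(1) _ s, where U = R])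
      (use h in \<open>simp_all add: lin tensor_lift_pure tw_mul_iA EA_tw scalars iB_mul_iA\<close>)
  then show "tensor_lift K A A R (\<lambda>e f. tmul (iB (EA (tmul (tw b a) (iA e)))) (iA f)) A.casimir = tw b a"
    using h by (simp add: lin A.casimir_snake_left)
qed (simp_all add: lin)

text \<open>Here \<open>f\<close> arrives from the left, so \<open>x = a b\<close> is the form to
  check: \<open>\<Sum> e \<epsilon>_A(f a) b = a b\<close>.\<close>

lemma EA_casimir_right:
  assumes x: "x \<in> carrier R"
  shows "tensor_lift K A A R (\<lambda>e f. tmul (iA e) (iB (EA (tmul (iA f) x)))) A.casimir = x"
proof (rule tensor_ext[OF _ _ A.vs(1) B.vs(1) _ x, where U = R])
  fix a b assume h: "a \<in> carrier A" "b \<in> carrier B"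
  have "tensor_lift K A A R (\<lambda>e f. tmul (iA e) (iB (EA (tmul (iA f) (P a b))))) s
      = P (tensor_lift K A A A (\<lambda>e f. epsilonA (A.mul f a) \<odot>\<^bsub>A\<^esub> e) s) b" if s: "s \<in> carrier (tensor K A A)" for s
    by (rule tensor_ext[OF _ _ A.vs(1) A.vs(1) _ s, where U = R])
      (use h in \<open>simp_all add: lin tensor_lift_pure iA_mul_pure EA_pure scalars A.mul_unt_right\<close>)
  then show "tensor_lift K A A R (\<lambda>e f. tmul (iA e) (iB (EA (tmul (iA f) (P a b))))) A.casimir = P a b"
    using h by (simp add: lin A.casimir_snake_right)
qed (simp_all add: lin)

text \<open>For \<open>x = a b\<close> the factor \<open>u\<close> joins \<open>b\<close>, and the
  sum becomes \<open>a \<Sum> \<epsilon>_B(b u) v = a b\<close>.\<close>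

lemma EB_casimir_left:
  assumes x: "x \<in> carrier R"
  shows "tensor_lift K B B R (\<lambda>u v. tmul (iA (EB (tmul x (iB u)))) (iB v)) B.casimir = x"
proof (rule tensor_ext[OF _ _ A.vs(1) B.vs(1) _ x, where U = R])
  fix a b assume h: "a \<in> carrier A" "b \<in> carrier B"
  have "tensor_lift K B B R (\<lambda>u v. tmul (iA (EB (tmul (P a b) (iB u)))) (iB v)) s
      = P a (tensor_lift K B B B (\<lambda>u v. epsilonB (B.mul b u) \<odot>\<^bsub>B\<^esub> v) s)" if s: "s \<in> carrier (tensor K B B)" for s
    by (rule tensor_ext[OF _ _ B.vs(1) B.vs(1) _ s, where U = R])
      (use h in \<open>simp_all add: lin tensor_lift_pure iB_mul_pure EB_pure scalars B.mul_unt_left\<close>)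
  then show "tensor_lift K B B R (\<lambda>u v. tmul (iA (EB (tmul (P a b) (iB u)))) (iB v)) B.casimir = P a b"
    using h by (simp add: lin B.casimir_snake_left)
qed (simp_all add: lin)

text \<open>For \<open>x = b a\<close> the factor \<open>v\<close> joins \<open>b\<close>,
  \<open>EB_tw\<close> applies to \<open>v b a\<close>, and the sum becomes
  \<open>\<Sum> u \<epsilon>_B(v b) a = b a\<close>.\<close>

lemma EB_casimir_right:
  assumes x: "x \<in> carrier R"
  shows "tensor_lift K B B R (\<lambda>u v. tmul (iB u) (iA (EB (tmul (iB v) x)))) B.casimir = x"
proof (rule twisted_ext[OF _ _ _ x, where U = R])
  fix b a assume h: "b \<in> carrier B" "a \<in> carrier A"
  have "tensor_lift K B B R (\<lambda>u v. tmul (iB u) (iA (EB (tmul (iB v) (tw b a))))) s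
      = tw (tensor_lift K B B B (\<lambda>u v. epsilonB (B.mul v b) \<odot>\<^bsub>B\<^esub> u) s) a" if s: "s \<in> carrier (tensor K B B)" for s
    by (rule tensor_ext[OF _ _ B.vs(1) B.vs(1) _ s, where U = R])
      (use h in \<open>simp_all add: lin tensor_lift_pure iB_mul_tw EB_tw scalars iB_mul_iA\<close>)
  then show "tensor_lift K B B R (\<lambda>u v. tmul (iB u) (iA (EB (tmul (iB v) (tw b a))))) B.casimir = tw b a"
    using h by (simp add: lin B.casimir_snake_right)
qed (simp_all add: lin)

section \<open>Duality of the Casimir element of the twisted product\<close>

abbreviation CR where "CR \<equiv> mid' (pm A.casimir B.casimir)"

text \<open>With \<open>\<tau>(\<Sum> b' \<otimes> a') = f u\<close> and \<open>y = EA(x e)\<close>,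
  the partial counits give \<open>\<Sum> \<epsilon>(x e b') a' = \<Sum> \<epsilon>_B(y b') a' = EB(y
  f u)\<close>. So the left side is \<open>\<Sum> EB(EA(x e) f u) v\<close>, to which the two
  reconstruction formulas apply in turn.\<close>

lemma twisted_snake_left:
  assumes x: "x \<in> carrier R"
  shows "tensor_lift K R R R (\<lambda>p q. eps (tmul x p) \<odot>\<^bsub>R\<^esub> q) CR = x"
proof -
  let ?L = "\<lambda>y. tensor_lift K R R R (\<lambda>p q. eps (tmul x p) \<odot>\<^bsub>R\<^esub> q) y"
  let ?M = "\<lambda>e f u v. tmul (iA (EB (tmul (tmul (iB (EA (tmul x (iA e)))) (iA f)) (iB u)))) (iB v)"
  have 1: "?L (tensor_lift K B A RR (\<lambda>b' a'. pR (P e b') (P a' v)) t)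
      = tmul (iA (EB (tmul (iB (EA (tmul x (iA e)))) (tau t)))) (iB v)"
    if h: "e \<in> carrier A" "v \<in> carrier B" and t: "t \<in> carrier (tensor K B A)" for e v t
  proof (rule tensor_ext[OF _ _ B.vs(1) A.vs(1) _ t, where U = R])
    fix b' a' assume h': "b' \<in> carrier B" "a' \<in> carrier A"
    have "eps (tmul x (P e b')) = epsilonB (B.mul (EA (tmul x (iA e))) b')"
      using h h' x AB.mul_assoc[of x "iA e" "iB b'"]
      by (simp add: lin iA_mul_iB eps_EA flip: EA_iB_right)
    then show "?L (tensor_lift K B A RR (\<lambda>b' a'. pR (P e b') (P a' v)) (pure_tensor K B A b' a'))
      = tmul (iA (EB (tmul (iB (EA (tmul x (iA e)))) (tw b' a')))) (iB v)"
      using h h' x by (simp add: lin tensor_lift_pure iB_mul_tw EB_tw scalars iA_mul_iB)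
  qed (use h x in \<open>simp_all add: lin\<close>)
  \<comment> \<open>The sum over \<open>e\<close> and \<open>f\<close> is placed outside: for fixed
    \<open>e\<close> and \<open>f\<close>, the inner sum over \<open>u\<close> and \<open>v\<close>
    is the reconstruction of \<open>EA(x e) f\<close> through \<open>EB\<close>.\<close>
  have 2: "?L (mid' (pm s t)) = tensor_lift K A A R (\<lambda>e f. tensor_lift K B B R (\<lambda>u v. ?M e f u v) t) s"
    if s: "s \<in> carrier (tensor K A A)" and t: "t \<in> carrier (tensor K B B)" for s t
  proof (rule tensor_ext[OF _ _ A.vs(1) A.vs(1) _ s, where U = R])
    fix e f assume h: "e \<in> carrier A" "f \<in> carrier A"
    have "?L (mid' (pm (pure_tensor K A A e f) t)) = tensor_lift K B B R (\<lambda>u v. ?M e f u v) t"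
      by (rule tensor_ext[OF _ _ B.vs(1) B.vs(1) _ t, where U = R])
        (use h x in \<open>simp_all add: lin tensor_lift_pure mid'_pure 1 tau_tau' AB.mul_assoc iA_mul_iB\<close>)
    then show "?L (mid' (pm (pure_tensor K A A e f) t))
        = tensor_lift K A A R (\<lambda>e f. tensor_lift K B B R (\<lambda>u v. ?M e f u v) t) (pure_tensor K A A e f)"
      using h t x by (simp add: lin tensor_lift_pure)
  qed (use t x in \<open>simp_all add: lin\<close>)
  have "?L CR = tensor_lift K A A R (\<lambda>e f. tensor_lift K B B R (\<lambda>u v. ?M e f u v) B.casimir) A.casimir"
    by (rule 2) (simp_all add: lin)
  also have "\<dots> = tensor_lift K A A R (\<lambda>e f. tmul (iB (EA (tmul x (iA e)))) (iA f)) A.casimir"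
    by (rule tensor_lift_cong) (use x in \<open>simp_all add: lin EB_casimir_left\<close>)
  also have "\<dots> = x" by (rule EA_casimir_left[OF x])
  finally show ?thesis .
qed

text \<open>With \<open>z = EB(v x)\<close>, the partial counits give \<open>\<Sum> \<epsilon>(a' v
  x) b' = \<Sum> \<epsilon>_A(a' z) b' = EA(f u z)\<close>, so the left side is
  \<open>\<Sum> e EA(f u EB(v x))\<close>.\<close>

lemma twisted_snake_right:
  assumes x: "x \<in> carrier R"
  shows "tensor_lift K R R R (\<lambda>p q. eps (tmul q x) \<odot>\<^bsub>R\<^esub> p) CR = x"
proof -
  let ?L = "\<lambda>y. tensor_lift K R R R (\<lambda>p q. eps (tmul q x) \<odot>\<^bsub>R\<^esub> p) y"
  let ?M = "\<lambda>u v e f. tmul (iA e) (iB (EA (tmul (iA f) (tmul (iB u) (iA (EB (tmul (iB v) x)))))))"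
  have 1: "?L (tensor_lift K B A RR (\<lambda>b' a'. pR (P e b') (P a' v)) t)
      = tmul (iA e) (iB (EA (tmul (tau t) (iA (EB (tmul (iB v) x))))))"
    if h: "e \<in> carrier A" "v \<in> carrier B" and t: "t \<in> carrier (tensor K B A)" for e v t
  proof (rule tensor_ext[OF _ _ B.vs(1) A.vs(1) _ t, where U = R])
    fix b' a' assume h': "b' \<in> carrier B" "a' \<in> carrier A"
    have "eps (tmul (P a' v) x) = epsilonA (A.mul a' (EB (tmul (iB v) x)))"
      using h h' x AB.mul_assoc[of "iA a'" "iB v" x]
      by (simp add: lin iA_mul_iB eps_EB flip: EB_iA_left)
    then show "?L (tensor_lift K B A RR (\<lambda>b' a'. pR (P e b') (P a' v)) (pure_tensor K B A b' a'))
      = tmul (iA e) (iB (EA (tmul (tw b' a') (iA (EB (tmul (iB v) x))))))"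
      using h h' x by (simp add: lin tensor_lift_pure tw_mul_iA EA_tw scalars iA_mul_iB)
  qed (use h x in \<open>simp_all add: lin\<close>)
  \<comment> \<open>Now the sum over \<open>u\<close> and \<open>v\<close> is outside, because the
    element \<open>u EB(v x)\<close> to be reconstructed by the inner sum depends on them.\<close>
  have 2: "?L (mid' (pm s t)) = tensor_lift K B B R (\<lambda>u v. tensor_lift K A A R (\<lambda>e f. ?M u v e f) s) t"
    if s: "s \<in> carrier (tensor K A A)" and t: "t \<in> carrier (tensor K B B)" for s t
  proof (rule tensor_ext[OF _ _ B.vs(1) B.vs(1) _ t, where U = R])
    fix u v assume h: "u \<in> carrier B" "v \<in> carrier B"
    have "?L (mid' (pm s (pure_tensor K B B u v))) = tensor_lift K A A R (\<lambda>e f. ?M u v e f) s"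
      by (rule tensor_ext[OF _ _ A.vs(1) A.vs(1) _ s, where U = R])
        (use h x in \<open>simp_all add: lin tensor_lift_pure mid'_pure 1 tau_tau' AB.mul_assoc[symmetric] iA_mul_iB\<close>)
    then show "?L (mid' (pm s (pure_tensor K B B u v)))
        = tensor_lift K B B R (\<lambda>u v. tensor_lift K A A R (\<lambda>e f. ?M u v e f) s) (pure_tensor K B B u v)"
      using h s x by (simp add: lin tensor_lift_pure)
  qed (use s x in \<open>simp_all add: lin\<close>)
  have "?L CR = tensor_lift K B B R (\<lambda>u v. tensor_lift K A A R (\<lambda>e f. ?M u v e f) A.casimir) B.casimir"
    by (rule 2) (simp_all add: lin)
  also have "\<dots> = tensor_lift K B B R (\<lambda>u v. tmul (iB u) (iA (EB (tmul (iB v) x)))) B.casimir"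
    by (rule tensor_lift_cong) (use x in \<open>simp_all add: lin EA_casimir_right\<close>)
  also have "\<dots> = x" by (rule EB_casimir_right[OF x])
  finally show ?thesis .
qed

lemma CR_closed [lin]: "CR \<in> carrier RR"
  by (simp add: lin)

lemmas CR_central = AB.casimir_central[OF eps_linear CR_closed twisted_snake_left twisted_snake_right]

section \<open>The comultiplication of the twisted product in terms of \<open>CR\<close>\<close>

text \<open>By \<open>\<Delta>_A(a) = a \<Delta>_A(1)\<close> and
  \<open>\<Delta>_B(b) = \<Delta>_B(1) b\<close>, the elements \<open>a\<close> and \<open>b\<close>
  multiply the outermost legs, while the inverse twist acts only on the two middle ones.\<close>

lemma twisted_comult_pure_casimir:
  assumes h: "a \<in> carrier A" "b \<in> carrier B"
  shows "twisted_comult K A DeltaA B DeltaB tau (P a b)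
    = tensor_lift K R R RR (\<lambda>p q. pR (tmul (iA a) p) (tmul q (iB b))) CR"
proof -
  let ?D = "\<lambda>y. tensor_lift K R R RR (\<lambda>p q. pR (tmul (iA a) p) (tmul q (iB b))) y"
  let ?l = "\<lambda>s. tensor_lift K A A (tensor K A A) (\<lambda>p q. pure_tensor K A A (A.mul a p) q) s"
  let ?r = "\<lambda>t. tensor_lift K B B (tensor K B B) (\<lambda>p q. pure_tensor K B B p (B.mul q b)) t"
  have 1: "?D (tensor_lift K B A RR (\<lambda>b' a'. pR (P e b') (P a' v)) t)
      = tensor_lift K B A RR (\<lambda>b' a'. pR (P (A.mul a e) b') (P a' (B.mul v b))) t"
    if h': "e \<in> carrier A" "v \<in> carrier B" and t: "t \<in> carrier (tensor K B A)" for e v t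
    by (rule tensor_ext[OF _ _ B.vs(1) A.vs(1) _ t, where U = RR])
      (use h h' in \<open>simp_all add: lin tensor_lift_pure iA_mul_pure iB_mul_pure\<close>)
  have 2: "mid' (pm (?l s) (?r t)) = ?D (mid' (pm s t))"
    if s: "s \<in> carrier (tensor K A A)" and t: "t \<in> carrier (tensor K B B)" for s t
  proof (rule tensor_ext[OF _ _ A.vs(1) A.vs(1) _ s, where U = RR])
    fix e f assume h': "e \<in> carrier A" "f \<in> carrier A"
    show "mid' (pm (?l (pure_tensor K A A e f)) (?r t)) = ?D (mid' (pm (pure_tensor K A A e f) t))"
      by (rule tensor_ext[OF _ _ B.vs(1) B.vs(1) _ t, where U = RR])
        (use h h' in \<open>simp_all add: lin tensor_lift_pure mid'_pure 1\<close>)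
  qed (use h t in \<open>simp_all add: lin\<close>)
  show ?thesis
    using h 2[of A.casimir B.casimir]
    by (simp add: lin twisted_comult_pure A.Delta_casimir_right[OF h(1)] B.Delta_casimir_left[OF h(2)])
qed

lemma twisted_comult_casimir:
  assumes x: "x \<in> carrier R"
  shows "twisted_comult K A DeltaA B DeltaB tau x = tensor_lift K R R RR (\<lambda>p q. pR (tmul x p) q) CR"
proof (rule tensor_ext[OF AB.Delta_linear _ A.vs(1) B.vs(1) _ x])
  fix a b assume h: "a \<in> carrier A" "b \<in> carrier B"
  have 1: "tensor_lift K R R RR (\<lambda>p q. pR (tmul (iA a) p) (tmul q (iB b))) y
    = tensor_lift K R R RR (\<lambda>p q. pR (tmul (iA a) p) q) (tensor_lift K R R RR (\<lambda>p q. pR p (tmul q (iB b))) y)"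
    if y: "y \<in> carrier RR" for y
    by (rule tensor_ext[OF _ _ AB.vs(1) AB.vs(1) _ y, where U = RR])
      (use h in \<open>simp_all add: lin tensor_lift_pure\<close>)
  have 2: "tensor_lift K R R RR (\<lambda>p q. pR (tmul (P a b) p) q) y
    = tensor_lift K R R RR (\<lambda>p q. pR (tmul (iA a) p) q) (tensor_lift K R R RR (\<lambda>p q. pR (tmul (iB b) p) q) y)"
    if y: "y \<in> carrier RR" for y
    by (rule tensor_ext[OF _ _ AB.vs(1) AB.vs(1) _ y, where U = RR])
      (use h in \<open>simp_all add: lin tensor_lift_pure iA_mul_iB AB.mul_assoc[symmetric]\<close>)
  show "twisted_comult K A DeltaA B DeltaB tau (P a b) = tensor_lift K R R RR (\<lambda>p q. pR (tmul (P a b) p) q) CR"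
    \<comment> \<open>Centrality is applied to \<open>iB b\<close> alone:
      \<open>a (C b) = a (b C) = (a b) C\<close>.\<close>
    unfolding twisted_comult_pure_casimir[OF h] 1[OF CR_closed] 2[OF CR_closed]
    by (subst CR_central) (use h in \<open>simp_all add: lin\<close>)
qed (simp_all add: lin)

lemma twisted_frobenius_algebra:
  "frobenius_algebra K R (twisted_mult K A nablaA B nablaB tau) (twisted_unit K A etaA B etaB)
     (twisted_comult K A DeltaA B DeltaB tau) (twisted_counit K A epsilonA B epsilonB)"
proof (rule AB.frobenius_algebraI[OF AB.k_coalgebra_axioms CR_closed twisted_comult_casimir])
  fix x assume x: "x \<in> carrier R"
  show "twisted_comult K A DeltaA B DeltaB tau x = tensor_lift K R R RR (\<lambda>p q. pR p (tmul q x)) CR"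
    unfolding twisted_comult_casimir[OF x] by (rule CR_central[OF _ _ x])
qed

end

theorem theorem1p2:
  fixes K :: "('k, 'm) ring_scheme"
    and A :: "('k, 'a, 'n) module_scheme" and B :: "('k, 'b, 'p) module_scheme"
  assumes "frobenius_algebra K A nablaA etaA DeltaA epsilonA"
    and "frobenius_algebra K B nablaB etaB DeltaB epsilonB"
    and "twisting_map K A nablaA etaA B nablaB etaB tau"
  shows "frobenius_algebra K (tensor K A B)
           (twisted_mult K A nablaA B nablaB tau) (twisted_unit K A etaA B etaB)
           (twisted_comult K A DeltaA B DeltaB tau) (twisted_counit K A epsilonA B epsilonB)
     \<longleftrightarrow> k_coalgebra K (tensor K A B)
           (twisted_comult K A DeltaA B DeltaB tau) (twisted_counit K A epsilonA B epsilonB)"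
  \<comment> \<open>The forward implication extracts the coalgebra part of a Frobenius
    algebra.\<close>
  using twisted_frobenius.twisted_frobenius_algebra[OF twisted_frobenius.intro[OF assms]]
    frobenius_algebra.axioms(2) by blast

end
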